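(* Let $q$ be an odd prime power and $n\ge2$ an integer such that $(q^n-1)/2$ is odd. Then for every $\beta\in\mathbb{F}_q$ there exists a $2$-primitive element $\xi\in\mathbb{F}_{q^n}$ with $\mathrm{Tr}(\xi)=\beta$.
   Context: An element of $\mathbb{F}_{q^n}$ is $2$-primitive if its multiplicative order is $(q^n-1)/2$. $\mathrm{Tr}:\mathbb{F}_{q^n}\to\mathbb{F}_q$, $\mathrm{Tr}(\xi)=\sum_{i=0}^{n-1}\xi^{q^i}$. *)

theory Defs
  imports "HOL-Number_Theory.Number_Theory" "HOL-Library.Cardinality"
begin

definition is_subfield :: "'a::field set \<Rightarrow> bool" where
  "is_subfield F \<longleftrightarrow> 0 \<in> F \<and> 1 \<in> F \<and>
     (\<forall>x\<in>F. \<forall>y\<in>F. x - y \<in> F \<and> x * y \<in> F) \<and> (\<forall>x\<in>F. inverse x \<in> F)"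

text \<open>The value 0 marks elements without finite multiplicative order, in particular \<open>x = 0\<close>.\<close>

definition mult_order :: "'a::field \<Rightarrow> nat" where
  "mult_order x = (if \<exists>k>0. x ^ k = 1 then LEAST k. k > 0 \<and> x ^ k = 1 else 0)"

text \<open>Here \<open>'a\<close> plays the role of the field with \<open>q ^ n\<close> elements. For odd \<open>q\<close> the
  division is exact.\<close>

definition two_primitive :: "nat \<Rightarrow> nat \<Rightarrow> 'a::field \<Rightarrow> bool" where
  "two_primitive q n x \<longleftrightarrow> mult_order x = (q ^ n - 1) div 2"

definition field_trace :: "nat \<Rightarrow> nat \<Rightarrow> 'a::field \<Rightarrow> 'a" where
  "field_trace q n x = (\<Sum>i<n. x ^ (q ^ i))"

end

theory Submission
  imports Defs Complex_Main "HOL-Computational_Algebra.Polynomial"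
begin

text \<open>
  As \<open>(q ^ n - 1) / 2\<close> is odd, \<open>n\<close> is odd, \<open>q\<close> is \<open>3\<close> modulo \<open>4\<close>, and \<open>\<xi>\<close> is 2-primitive if and
  only if \<open>- \<xi>\<close> is primitive. So it suffices to find primitive elements of every trace, which is
  Cohen's theorem.

  Fix a generator \<open>g\<close> and let \<open>E\<close> be the set of exponents \<open>i\<close> with \<open>Tr (g ^ i) = \<beta>\<close>; an exponent
  coprime to \<open>N = q ^ n - 1\<close> is wanted. No Gauss sums are needed to bound the nontrivial Fourier
  coefficients of \<open>E\<close> modulo \<open>N\<close>: for \<open>t\<close> outside the subfield, \<open>Tr y = \<beta>\<close> and \<open>Tr (t y) = \<beta>\<close> are
  independent conditions, so the autocorrelation of the trace fibre, and with it the absolute value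
  of each coefficient, is known exactly. The bounds feed two sieves. The first is Moebius inversion
  over the primes dividing \<open>N\<close>, which succeeds when \<open>2 ^ \<omega>\<close> is at most the square root of the main
  term. The second is a union bound over these primes, which is stronger when there are few of them.
  For \<open>\<beta> = 0\<close> only the primes dividing \<open>Q = N / (q - 1)\<close> matter, because multiplying by an element
  of the subfield preserves trace zero. Comparing \<open>N\<close> and \<open>Q\<close> with products of small primes leaves
  finitely many pairs \<open>(q, n)\<close>, which are settled by explicit factorisations.
\<close>

section \<open>Sieving with exponential sums\<close>

definition unit_char :: "nat \<Rightarrow> nat \<Rightarrow> nat \<Rightarrow> complex" where
  "unit_char N k i = cis (2 * pi * real (k * i) / real N)"

lemma norm_unit_char [simp]: "norm (unit_char N k i) = 1"
  by (simp add: unit_char_def)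

lemma unit_char_add_left: "unit_char N (k + l) i = unit_char N k i * unit_char N l i"
  by (simp add: unit_char_def cis_mult algebra_simps add_divide_distrib)

lemma unit_char_add_right: "unit_char N k (i + j) = unit_char N k i * unit_char N k j"
  by (simp add: unit_char_def cis_mult algebra_simps add_divide_distrib)

lemma unit_char_power: "unit_char N k i ^ m = unit_char N (m * k) i"
  by (simp add: unit_char_def DeMoivre mult_ac)

lemma unit_char_eq_1_iff:
  assumes "N > 0"
  shows "unit_char N k i = 1 \<longleftrightarrow> N dvd k * i"
proof
  assume "unit_char N k i = 1"
  hence "cos (2 * pi * real (k * i) / real N) = 1"
    by (simp add: unit_char_def complex_eq_iff)
  then obtain m :: int where "2 * pi * real (k * i) / real N = real_of_int m * 2 * pi"
    by (auto simp: cos_one_2pi_int)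
  hence "real (k * i) = real_of_int m * real N"
    using assms by (simp add: field_simps)
  hence "int (k * i) = m * int N"
    by (metis of_int_eq_iff of_int_mult of_int_of_nat_eq)
  hence "int N dvd int (k * i)" by simp
  thus "N dvd k * i" by (simp only: int_dvd_int_iff)
next
  assume "N dvd k * i"
  then obtain m where m: "k * i = N * m" by blast
  have "2 * pi * real (k * i) / real N = 2 * pi * real m"
    unfolding m using assms by simp
  thus "unit_char N k i = 1"
    unfolding unit_char_def by (simp add: cis_multiple_2pi)
qed

lemma sum_unit_char_left:
  assumes "p > 0"
  shows "(\<Sum>j<p. unit_char p j i) = (if p dvd i then of_nat p else 0)"
proof -
  have eq: "unit_char p j i = unit_char p 1 i ^ j" for j
    by (simp add: unit_char_power)
  show ?thesis
  proof (cases "p dvd i")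
    case True
    hence "unit_char p j i = 1" for j
      using assms by (simp add: unit_char_eq_1_iff)
    thus ?thesis using True by simp
  next
    case False
    hence "unit_char p 1 i \<noteq> 1"
      using assms by (simp add: unit_char_eq_1_iff)
    moreover have "unit_char p 1 i ^ p = 1"
      using assms unfolding unit_char_power by (simp add: unit_char_eq_1_iff)
    ultimately show ?thesis
      using False by (subst eq) (simp add: geometric_sum)
  qed
qed

section \<open>Detecting divisibility by a prime through twisted sums\<close>

lemma unit_char_div:
  assumes "p dvd N" "N > 0"
  shows "unit_char N (j * (N div p)) i = unit_char p j i"
proof -
  obtain m where "N = p * m" using assms by blast
  thus ?thesis using assms by (simp add: unit_char_def field_simps)
qed

lemma unit_char_mod:
  assumes "N > 0"
  shows "unit_char N k (i mod N) = unit_char N k i"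
proof -
  have "unit_char N k i = unit_char N k (N * (i div N) + i mod N)" by simp
  also have "\<dots> = unit_char N k (N * (i div N)) * unit_char N k (i mod N)"
    by (rule unit_char_add_right)
  also have "unit_char N k (N * (i div N)) = 1"
    using assms by (simp add: unit_char_eq_1_iff)
  finally show ?thesis by simp
qed

text \<open>Averaging the \<open>p\<close> characters modulo \<open>p\<close> detects
  \<open>p dvd i\<close>. Each of them is the character modulo \<open>N\<close> of index
  \<open>j * (N div p)\<close>, so it merely shifts \<open>k\<close>.\<close>

lemma sum_unit_char_dvd:
  assumes "p dvd N" "N > 0" "finite A"
  shows "of_nat p * (\<Sum>i\<in>{i\<in>A. p dvd i}. unit_char N k i)
           = (\<Sum>j<p. \<Sum>i\<in>A. unit_char N (k + j * (N div p)) i)"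
proof -
  have p: "p > 0" using assms by (auto intro: Nat.gr0I)
  have "(\<Sum>j<p. \<Sum>i\<in>A. unit_char N (k + j * (N div p)) i)
      = (\<Sum>i\<in>A. unit_char N k i * (\<Sum>j<p. unit_char p j i))"
    by (subst sum.swap)
       (simp add: unit_char_add_left unit_char_div[OF assms(1,2)] sum_distrib_left)
  also have "\<dots> = (\<Sum>i\<in>A. if p dvd i then of_nat p * unit_char N k i else 0)"
    by (intro sum.cong refl) (simp add: sum_unit_char_left[OF p])
  also have "\<dots> = of_nat p * (\<Sum>i\<in>{i\<in>A. p dvd i}. unit_char N k i)"
    using assms(3) by (simp add: sum.If_cases sum_distrib_left Int_def)
  finally show ?thesis ..
qed

lemma sum_unit_char_not_dvd:
  assumes "p dvd N" "N > 0" "finite A"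
  shows "(\<Sum>i\<in>{i\<in>A. \<not> p dvd i}. unit_char N k i)
           = (1 - 1 / of_nat p) * (\<Sum>i\<in>A. unit_char N k i)
             - (1 / of_nat p) * (\<Sum>j\<in>{1..<p}. \<Sum>i\<in>A. unit_char N (k + j * (N div p)) i)"
proof -
  have p: "p > 0" using assms by (auto intro: Nat.gr0I)
  have *: "{..<p} = insert 0 {1..<p}" using p by auto
  have "(\<Sum>i\<in>A. unit_char N k i)
      = (\<Sum>i\<in>{i\<in>A. p dvd i}. unit_char N k i) + (\<Sum>i\<in>{i\<in>A. \<not> p dvd i}. unit_char N k i)"
    using assms(3) by (subst sum.union_disjoint [symmetric]) (auto intro!: sum.cong)
  moreover have "of_nat p * (\<Sum>i\<in>{i\<in>A. p dvd i}. unit_char N k i)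
      = (\<Sum>i\<in>A. unit_char N k i) + (\<Sum>j\<in>{1..<p}. \<Sum>i\<in>A. unit_char N (k + j * (N div p)) i)"
    unfolding sum_unit_char_dvd[OF assms] * by simp
  ultimately show ?thesis using p by (simp add: field_simps)
qed

text \<open>For \<open>k = 0\<close> in \<open>sum_unit_char_dvd\<close> the term
  \<open>j = 0\<close> is the expected count \<open>card E\<close>; the other \<open>p - 1\<close>
  twists are nontrivial and cost \<open>B\<close> each.\<close>

lemma card_dvd_le:
  assumes "p dvd N" "N > 0" "finite E"
    and bound: "\<And>k. \<not> N dvd k \<Longrightarrow> norm (\<Sum>i\<in>E. unit_char N k i) \<le> B"
  shows "real p * real (card {i\<in>E. p dvd i}) \<le> real (card E) + (real p - 1) * B"
proof -
  have p: "p > 0" using assms by (auto intro: Nat.gr0I)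
  have *: "{..<p} = insert 0 {1..<p}" using p by auto
  have one: "unit_char N 0 i = 1" for i by (simp add: unit_char_def)
  have nd: "\<not> N dvd j * (N div p)" if "j \<in> {1..<p}" for j
  proof
    assume "N dvd j * (N div p)"
    moreover obtain m where m: "N = p * m" using assms by blast
    ultimately have "p dvd j" using p assms(2) by simp
    thus False using that by (auto dest: dvd_imp_le)
  qed
  have "of_nat p * (\<Sum>i\<in>{i\<in>E. p dvd i}. unit_char N 0 i)
      = of_nat (card E) + (\<Sum>j\<in>{1..<p}. \<Sum>i\<in>E. unit_char N (j * (N div p)) i)"
    unfolding sum_unit_char_dvd[OF assms(1-3)] * by (simp add: one)
  hence "complex_of_real (real p * real (card {i\<in>E. p dvd i}) - real (card E))
      = (\<Sum>j\<in>{1..<p}. \<Sum>i\<in>E. unit_char N (j * (N div p)) i)"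
    by (simp add: one)
  hence "\<bar>real p * real (card {i\<in>E. p dvd i}) - real (card E)\<bar>
      = norm (\<Sum>j\<in>{1..<p}. \<Sum>i\<in>E. unit_char N (j * (N div p)) i)"
    by (metis norm_of_real)
  also have "\<dots> \<le> (\<Sum>j\<in>{1..<p}. B)"
    using nd by (intro sum_norm_le bound)
  also have "\<dots> = (real p - 1) * B" using p by (simp add: of_nat_diff)
  finally show ?thesis by linarith
qed

text \<open>Sifting by one more prime \<open>p\<close> turns the sum for \<open>k\<close> into sums for \<open>k + j N / p\<close>, so the induction
  needs the bound for all twists that stay nontrivial.\<close>

lemma sum_unit_char_sifted:
  assumes "finite P" "N > 0" "finite E"
    and bound: "\<And>k. \<not> N dvd k \<Longrightarrow> norm (\<Sum>i\<in>E. unit_char N k i) \<le> B"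
    and "\<And>p. p \<in> P \<Longrightarrow> prime p \<and> p dvd N"
  shows "(\<forall>k. \<not> N dvd k * \<Prod>P \<longrightarrow>
            norm (\<Sum>i\<in>{i\<in>E. \<forall>p\<in>P. \<not> p dvd i}. unit_char N k i)
              \<le> (\<Prod>p\<in>P. 1 - 1 / real p) * 2 ^ card P * B) \<and>
         norm ((\<Sum>i\<in>{i\<in>E. \<forall>p\<in>P. \<not> p dvd i}. unit_char N 0 i)
               - of_real ((\<Prod>p\<in>P. 1 - 1 / real p) * real (card E)))
           \<le> (\<Prod>p\<in>P. 1 - 1 / real p) * (2 ^ card P - 1) * B"
  using assms(1,5)
proof (induction P rule: finite_induct)
  case empty
  have "unit_char N 0 i = 1" for i by (simp add: unit_char_def)
  thus ?case using bound by simp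
next
  case (insert p P)
  define A where "A = {i\<in>E. \<forall>p\<in>P. \<not> p dvd i}"
  define \<theta> where "\<theta> = (\<Prod>p\<in>P. 1 - 1 / real p)"
  define S where "S = (\<lambda>k. \<Sum>i\<in>A. unit_char N k i)"
  have prm: "prime p" "p dvd N" using insert.prems by auto
  have p: "p > 1" using prm prime_gt_1_nat by blast
  have fA: "finite A" using assms(3) by (simp add: A_def)
  have AA: "{i\<in>E. \<forall>p\<in>insert p P. \<not> p dvd i} = {i\<in>A. \<not> p dvd i}"
    by (auto simp: A_def)
  have IH1: "norm (S k) \<le> \<theta> * 2 ^ card P * B" if "\<not> N dvd k * \<Prod>P" for k
    using insert.IH insert.prems that by (simp add: A_def \<theta>_def S_def)
  have IH2: "norm (S 0 - of_real (\<theta> * real (card E))) \<le> \<theta> * (2 ^ card P - 1) * B"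
    using insert.IH insert.prems by (simp add: A_def \<theta>_def S_def)
  have rec: "(\<Sum>i\<in>{i\<in>A. \<not> p dvd i}. unit_char N k i)
     = of_real (1 - 1 / real p) * S k
       - of_real (1 / real p) * (\<Sum>j\<in>{1..<p}. S (k + j * (N div p)))" for k
    unfolding S_def by (simp add: sum_unit_char_not_dvd[OF prm(2) assms(2) fA])
  have \<theta>': "(\<Prod>p\<in>insert p P. 1 - 1 / real p) = (1 - 1 / real p) * \<theta>"
    using insert.hyps by (simp add: \<theta>_def)
  have c': "card (insert p P) = Suc (card P)" using insert.hyps by simp
  obtain m where m: "N = p * m" using prm by blast
  have m0: "m > 0" using m assms(2) by (auto intro: Nat.gr0I)
  \<comment> \<open>The \<open>p - 1\<close> twists, each weighted by \<open>1 / p\<close>, carry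
    total weight \<open>1 - 1 / p\<close>, exactly that of the untwisted term. Hence each prime
    doubles the error, while the density \<theta> remains a common factor.\<close>
  have tail: "norm (of_real (1 / real p) * (\<Sum>j\<in>{1..<p}. S (k + j * (N div p))))
      \<le> (1 - 1 / real p) * \<theta> * 2 ^ card P * B"
    if nd: "\<And>j. j \<in> {1..<p} \<Longrightarrow> \<not> N dvd (k + j * (N div p)) * \<Prod>P" for k
  proof -
    have "norm (\<Sum>j\<in>{1..<p}. S (k + j * (N div p))) \<le> (\<Sum>j\<in>{1..<p}. \<theta> * 2 ^ card P * B)"
      using nd by (intro sum_norm_le IH1)
    also have "\<dots> = (real p - 1) * (\<theta> * 2 ^ card P * B)" using p by (simp add: of_nat_diff)
    finally have "(1 / real p) * norm (\<Sum>j\<in>{1..<p}. S (k + j * (N div p)))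
        \<le> (1 / real p) * ((real p - 1) * (\<theta> * 2 ^ card P * B))"
      by (rule mult_left_mono) simp
    also have "\<dots> = (1 - 1 / real p) * \<theta> * 2 ^ card P * B" using p by (simp add: field_simps)
    finally show ?thesis by (simp add: norm_mult norm_divide)
  qed
  have pos: "1 - 1 / real p \<ge> 0" using p by simp
  have first: "norm (of_real (1 - 1 / real p) * z) = (1 - 1 / real p) * norm z" for z :: complex
    unfolding norm_mult norm_of_real using pos by simp
  show ?case unfolding AA \<theta>' c'
  proof (intro conjI allI impI)
    fix k assume k: "\<not> N dvd k * \<Prod>(insert p P)"
    hence k: "\<not> N dvd k * \<Prod>P * p" using insert.hyps by (simp add: mult_ac)
    have 1: "\<not> N dvd k * \<Prod>P" using k by (meson dvd_mult2)
    \<comment> \<open>Multiplying by \<open>p\<close> turns \<open>j * (N div p)\<close> into a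
      multiple of \<open>N\<close>, so the twist cannot make a nontrivial \<open>k\<close>
      trivial.\<close>
    have 2: "\<not> N dvd (k + j * (N div p)) * \<Prod>P" for j
    proof
      assume "N dvd (k + j * (N div p)) * \<Prod>P"
      hence "N dvd (k + j * (N div p)) * \<Prod>P * p" by (rule dvd_mult2)
      also have "(k + j * (N div p)) * \<Prod>P * p = k * \<Prod>P * p + N * (j * \<Prod>P)"
        using m p by (simp add: algebra_simps)
      finally show False using k by (simp add: dvd_add_left_iff)
    qed
    have "norm (\<Sum>i\<in>{i\<in>A. \<not> p dvd i}. unit_char N k i)
      \<le> (1 - 1 / real p) * norm (S k)
         + norm (of_real (1 / real p) * (\<Sum>j\<in>{1..<p}. S (k + j * (N div p))))"
      unfolding rec first [symmetric] by (rule norm_triangle_ineq4)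
    also have "\<dots> \<le> (1 - 1 / real p) * (\<theta> * 2 ^ card P * B)
         + (1 - 1 / real p) * \<theta> * 2 ^ card P * B"
      using pos 1 2 by (intro add_mono mult_left_mono IH1 tail)
    finally show "norm (\<Sum>i\<in>{i\<in>A. \<not> p dvd i}. unit_char N k i)
       \<le> (1 - 1 / real p) * \<theta> * 2 ^ Suc (card P) * B"
      by (simp add: algebra_simps)
  next
    have cp: "coprime p (\<Prod>P)"
    proof (rule prod_coprime_right)
      fix r assume "r \<in> P"
      thus "coprime p r"
        using insert.hyps insert.prems by (intro primes_coprime) auto
    qed
    \<comment> \<open>The untwisted index is now \<open>0\<close>, so nontriviality rests on
      \<open>0 < j < p\<close> and on \<open>p\<close> being coprime to the primes sifted
      before.\<close>
    have 2: "\<not> N dvd (0 + j * (N div p)) * \<Prod>P" if "j \<in> {1..<p}" for j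
    proof
      assume "N dvd (0 + j * (N div p)) * \<Prod>P"
      also have "(0 + j * (N div p)) * \<Prod>P = m * (j * \<Prod>P)" using m p by (simp add: mult_ac)
      finally have "p dvd j * \<Prod>P" using m m0 by (simp add: mult.commute)
      hence "p dvd j" using cp by (simp add: coprime_dvd_mult_left_iff)
      thus False using that by (auto dest: dvd_imp_le)
    qed
    have "(\<Sum>i\<in>{i\<in>A. \<not> p dvd i}. unit_char N 0 i)
           - of_real ((1 - 1 / real p) * \<theta> * real (card E))
        = of_real (1 - 1 / real p) * (S 0 - of_real (\<theta> * real (card E)))
          - of_real (1 / real p) * (\<Sum>j\<in>{1..<p}. S (0 + j * (N div p)))"
      unfolding rec by (simp add: algebra_simps)
    also have "norm \<dots> \<le> (1 - 1 / real p) * norm (S 0 - of_real (\<theta> * real (card E)))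
         + norm (of_real (1 / real p) * (\<Sum>j\<in>{1..<p}. S (0 + j * (N div p))))"
      unfolding first [symmetric] by (rule norm_triangle_ineq4)
    \<comment> \<open>The errors add up as
      \<open>(2 ^ card P - 1) + 2 ^ card P = 2 ^ Suc (card P) - 1\<close>.\<close>
    also have "\<dots> \<le> (1 - 1 / real p) * (\<theta> * (2 ^ card P - 1) * B)
         + (1 - 1 / real p) * \<theta> * 2 ^ card P * B"
      using pos 2 by (intro add_mono mult_left_mono IH2 tail)
    finally show "norm ((\<Sum>i\<in>{i\<in>A. \<not> p dvd i}. unit_char N 0 i)
           - of_real ((1 - 1 / real p) * \<theta> * real (card E)))
        \<le> (1 - 1 / real p) * \<theta> * (2 ^ Suc (card P) - 1) * B"
      by (simp add: algebra_simps)
  qed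
qed

section \<open>Sieve criteria: Moebius inversion and union bound\<close>

lemma card_sifted_ge:
  assumes "finite P" "N > 0" "finite E"
    and "\<And>k. \<not> N dvd k \<Longrightarrow> norm (\<Sum>i\<in>E. unit_char N k i) \<le> B"
    and "\<And>p. p \<in> P \<Longrightarrow> prime p \<and> p dvd N"
  shows "(\<Prod>p\<in>P. 1 - 1 / real p) * (real (card E) - (2 ^ card P - 1) * B)
           \<le> real (card {i\<in>E. \<forall>p\<in>P. \<not> p dvd i})"
proof -
  let ?c = "real (card {i\<in>E. \<forall>p\<in>P. \<not> p dvd i})"
  have "unit_char N 0 i = 1" for i by (simp add: unit_char_def)
  hence "norm (complex_of_real (?c - (\<Prod>p\<in>P. 1 - 1 / real p) * real (card E)))
      \<le> (\<Prod>p\<in>P. 1 - 1 / real p) * (2 ^ card P - 1) * B"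
    using sum_unit_char_sifted[OF assms] by simp
  hence "\<bar>?c - (\<Prod>p\<in>P. 1 - 1 / real p) * real (card E)\<bar>
      \<le> (\<Prod>p\<in>P. 1 - 1 / real p) * (2 ^ card P - 1) * B"
    unfolding norm_of_real .
  thus ?thesis by (simp add: algebra_simps)
qed

text \<open>Main term and error share the positive factor
  \<open>\<Prod>p\<in>P. 1 - 1 / real p\<close>, so only their other factors need comparing.\<close>

lemma sifted_nonempty_moebius:
  assumes "finite P" "N > 0" "finite E"
    and "\<And>k. \<not> N dvd k \<Longrightarrow> norm (\<Sum>i\<in>E. unit_char N k i) \<le> B"
    and "\<And>p. p \<in> P \<Longrightarrow> prime p \<and> p dvd N"
    and "(2 ^ card P - 1) * B < real (card E)"
  shows "{i\<in>E. \<forall>p\<in>P. \<not> p dvd i} \<noteq> {}"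
proof -
  have "(\<Prod>p\<in>P. 1 - 1 / real p) > 0"
  proof (rule prod_pos)
    fix p assume "p \<in> P"
    hence "real p > 1" using assms(5) prime_gt_1_nat[of p] by simp
    thus "1 - 1 / real p > 0" by simp
  qed
  hence "0 < (\<Prod>p\<in>P. 1 - 1 / real p) * (real (card E) - (2 ^ card P - 1) * B)"
    using assms(6) by simp
  also have "\<dots> \<le> real (card {i\<in>E. \<forall>p\<in>P. \<not> p dvd i})"
    using assms(1-5) by (rule card_sifted_ge)
  finally show ?thesis by (metis card.empty of_nat_0 less_irrefl)
qed

text \<open>If nothing survives, the multiples of the primes in \<open>P\<close> cover
  \<open>E\<close>, and \<open>card_dvd_le\<close> bounds each class. The error grows linearly in
  \<open>card P\<close> instead of exponentially, but the reciprocals of the primes now reduce the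
  main term.\<close>

lemma sifted_nonempty_union:
  assumes "finite P" "N > 0" "finite E"
    and "\<And>k. \<not> N dvd k \<Longrightarrow> norm (\<Sum>i\<in>E. unit_char N k i) \<le> B"
    and P: "\<And>p. p \<in> P \<Longrightarrow> prime p \<and> p dvd N"
    and "real (card E) * (\<Sum>p\<in>P. 1 / real p) + (real (card P) - (\<Sum>p\<in>P. 1 / real p)) * B
           < real (card E)"
  shows "{i\<in>E. \<forall>p\<in>P. \<not> p dvd i} \<noteq> {}"
proof
  assume "{i\<in>E. \<forall>p\<in>P. \<not> p dvd i} = {}"
  hence "E = (\<Union>p\<in>P. {i\<in>E. p dvd i})" by blast
  hence "card E \<le> (\<Sum>p\<in>P. card {i\<in>E. p dvd i})"
    using card_UN_le[OF assms(1), of "\<lambda>p. {i\<in>E. p dvd i}"] by simp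
  hence "real (card E) \<le> (\<Sum>p\<in>P. real (card {i\<in>E. p dvd i}))"
    by (metis of_nat_le_iff of_nat_sum)
  also have "\<dots> \<le> (\<Sum>p\<in>P. real (card E) * (1 / real p) + (1 - 1 / real p) * B)"
  proof (rule sum_mono)
    fix p assume p: "p \<in> P"
    have "real p * real (card {i\<in>E. p dvd i}) \<le> real (card E) + (real p - 1) * B"
      using P[OF p] assms(2-4) by (intro card_dvd_le) auto
    moreover have "real p > 0" using P[OF p] prime_gt_0_nat by simp
    ultimately show "real (card {i\<in>E. p dvd i}) \<le> real (card E) * (1 / real p) + (1 - 1 / real p) * B"
      by (simp add: field_simps)
  qed
  also have "\<dots> = real (card E) * (\<Sum>p\<in>P. 1 / real p) + (real (card P) - (\<Sum>p\<in>P. 1 / real p)) * B"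
    by (simp add: sum.distrib sum_distrib_left sum_distrib_right sum_subtractf left_diff_distrib)
  finally show False using assms(6) by simp
qed

section \<open>Numbers of prime divisors\<close>

text \<open>An exchange argument: members of \<open>P\<close> outside \<open>A\<close> are at least
  \<open>T\<close>, members of \<open>A\<close> missing from \<open>P\<close> are at most
  \<open>T\<close>. The bound means \<open>\<Prod>P \<ge> \<Prod>A * T ^ (card P - card A)\<close>,
  multiplied out so that it also makes sense when \<open>P\<close> has fewer elements than
  \<open>A\<close>.\<close>

lemma prod_ge_threshold:
  fixes P A :: "nat set"
  assumes "finite P" "finite A" "\<And>p. p \<in> P \<Longrightarrow> p \<in> A \<or> T \<le> p" "\<And>a. a \<in> A \<Longrightarrow> a \<le> T"
  shows "T ^ card P * \<Prod>A \<le> \<Prod>P * T ^ card A"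
proof -
  have PP: "\<Prod>P = \<Prod>(P \<inter> A) * \<Prod>(P - A)" "card P = card (P \<inter> A) + card (P - A)"
    using assms(1) by (simp_all add: prod.Int_Diff card_Int_Diff)
  have AA: "\<Prod>A = \<Prod>(P \<inter> A) * \<Prod>(A - P)" "card A = card (P \<inter> A) + card (A - P)"
    using assms(2) prod.Int_Diff[of A "\<lambda>x. x" P] card_Int_Diff[of A P]
    by (simp_all add: Int_commute)
  have 1: "T ^ card (P - A) \<le> \<Prod>(P - A)"
    using assms(3) prod_mono[of "P - A" "\<lambda>_. T" "\<lambda>x. x"] by auto
  have 2: "\<Prod>(A - P) \<le> T ^ card (A - P)"
    using assms(4) prod_mono[of "A - P" "\<lambda>x. x" "\<lambda>_. T"] by auto
  have "T ^ card P * \<Prod>A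
      = (T ^ card (P - A) * \<Prod>(A - P)) * (T ^ card (P \<inter> A) * \<Prod>(P \<inter> A))"
    unfolding PP(2) AA(1) power_add by (simp only: mult_ac)
  also have "\<dots> \<le> (\<Prod>(P - A) * T ^ card (A - P)) * (T ^ card (P \<inter> A) * \<Prod>(P \<inter> A))"
    using 1 2 by (intro mult_right_mono mult_mono) auto
  also have "\<dots> = \<Prod>P * T ^ card A"
    unfolding PP(1) AA(2) power_add by (simp only: mult_ac)
  finally show ?thesis .
qed

text \<open>The same exchange for reciprocals: \<open>1 / p - 1 / T\<close> is nonpositive on
  \<open>P - A\<close> and nonnegative on \<open>A - P\<close>.\<close>

lemma sum_inverse_le_threshold:
  fixes P A :: "nat set"
  assumes "finite P" "finite A" "\<And>p. p \<in> P \<Longrightarrow> p \<in> A \<or> T \<le> p"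
    and "\<And>a. a \<in> A \<Longrightarrow> 0 < a \<and> a \<le> T" "T > 0"
  shows "(\<Sum>p\<in>P. 1 / real p)
           \<le> (\<Sum>a\<in>A. 1 / real a) + (real (card P) - real (card A)) / real T"
proof -
  have "(\<Sum>p\<in>P. 1 / real p - 1 / real T) \<le> (\<Sum>p\<in>P \<inter> A. 1 / real p - 1 / real T)"
    unfolding sum.Int_Diff[OF assms(1), of _ A]
    using assms(3,5) by (fastforce intro!: sum_nonpos divide_left_mono mult_pos_pos)
  also have "\<dots> \<le> (\<Sum>p\<in>A. 1 / real p - 1 / real T)"
    using assms(2,4,5) by (intro sum_mono2) (auto intro!: divide_left_mono mult_pos_pos)
  finally show ?thesis by (simp add: sum_subtractf diff_divide_distrib)
qed

section \<open>Radicals and numbers of prime factors\<close>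

lemma prod_prime_factors_dvd:
  fixes m :: nat
  assumes "m > 0"
  shows "\<Prod>(prime_factors m) dvd m"
proof -
  have "\<Prod>(prime_factors m) dvd (\<Prod>p\<in>prime_factors m. p ^ multiplicity p m)"
    by (intro prod_dvd_prod) (auto simp: prime_factors_multiplicity)
  thus ?thesis using prime_factorization_nat[OF assms] by simp
qed

lemma prime_factors_prod_list:
  assumes "\<forall>p\<in>set ps. prime (p::nat)"
  shows "prime_factors (prod_list ps) = set ps"
  using assms
proof (induction ps)
  case (Cons p ps)
  have "0 \<notin> set ps" using Cons.prems by auto
  hence "prime_factors (p * prod_list ps) = prime_factors p \<union> prime_factors (prod_list ps)"
    using Cons.prems by (intro prime_factors_product) (auto simp: prod_list_zero_iff prime_gt_0_nat)
  thus ?case using Cons by (auto simp: prime_factorization_prime)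
qed simp

lemma card_prime_factors_le:
  fixes m :: nat
  assumes "m = prod_list ps" "\<forall>p\<in>set ps. prime p"
  shows "card (prime_factors m) \<le> card (set ps)"
  using assms by (simp add: prime_factors_prod_list)

lemma prime_less_17: "prime (p::nat) \<Longrightarrow> p < 17 \<Longrightarrow> p \<in> {2, 3, 5, 7, 11, 13}"
proof -
  assume p: "prime p" "p < 17"
  have "\<forall>p\<in>{0..<17}. prime p \<longrightarrow> p \<in> {2, 3, 5, 7, 11, 13 :: nat}"
    by (simp add: upto_aux_rec atLeastLessThan_nat_numeral)
  thus ?thesis using p by auto
qed

text \<open>\<open>17\<close> is the next prime after \<open>13\<close>. The set \<open>A\<close>
  can leave out small primes known not to divide \<open>m\<close>, which sharpens the bound.\<close>

lemma prime_factors_threshold_17: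
  fixes m :: nat
  assumes "A \<subseteq> {2, 3, 5, 7, 11, 13}" "\<And>p. p \<in> {2, 3, 5, 7, 11, 13} - A \<Longrightarrow> \<not> p dvd m"
  shows "17 ^ card (prime_factors m) * \<Prod>A \<le> \<Prod>(prime_factors m) * 17 ^ card A"
proof (rule prod_ge_threshold)
  show "finite A" using assms(1) by (rule finite_subset) simp
  show "p \<in> A \<or> 17 \<le> p" if "p \<in> prime_factors m" for p
    using that assms(2)[of p] prime_less_17[of p] unfolding in_prime_factors_iff
    by (meson DiffI leI)
qed (use assms in auto)

section \<open>Explicit primes by trial division\<close>

lemma prime_natI_sqrt:
  fixes p :: nat
  assumes "1 < p" "p < k * k" "\<forall>d\<in>set [2..<k]. \<not> d dvd p"
  shows "prime p"
proof (rule ccontr)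
  assume "\<not> prime p"
  then obtain a where a: "a dvd p" "a \<noteq> 1" "a \<noteq> p"
    using assms(1) by (auto simp: prime_nat_iff)
  then obtain b where p: "p = a * b" by blast
  hence "a \<noteq> 0" "b \<noteq> 0" "b \<noteq> 1" using a assms(1) by (auto intro: Nat.gr0I)
  hence ab: "p = a * b" "1 < a" "1 < b" using a p by auto
  hence "a < k \<or> b < k" using assms(2) by (meson leI mult_le_mono not_le)
  moreover have "\<not> d dvd p" if "1 < d" "d < k" for d
    using assms(3) that by auto
  ultimately show False using ab by (metis dvd_triv_left dvd_triv_right)
qed

lemma small_primes:
  "prime (2::nat)" "prime (3::nat)" "prime (5::nat)" "prime (7::nat)" "prime (11::nat)"
  "prime (13::nat)" "prime (19::nat)" "prime (23::nat)" "prime (29::nat)" "prime (31::nat)"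
  "prime (37::nat)" "prime (59::nat)" "prime (61::nat)" "prime (79::nat)"
  by simp_all

lemma large_primes:
  "prime (109::nat)" "prime (127::nat)" "prime (241::nat)" "prime (331::nat)" "prime (379::nat)"
  "prime (757::nat)" "prime (1093::nat)" "prime (2179::nat)" "prime (2801::nat)" "prime (3541::nat)"
  "prime (5419::nat)" "prime (14281::nat)"
proof -
  \<comment> \<open>Each \<open>k\<close> is the least number whose square exceeds the
    prime.\<close>
  show "prime (109::nat)" by (rule prime_natI_sqrt[where k = 11]) simp_all
  show "prime (127::nat)" by (rule prime_natI_sqrt[where k = 12]) simp_all
  show "prime (241::nat)" by (rule prime_natI_sqrt[where k = 16]) simp_all
  show "prime (331::nat)" by (rule prime_natI_sqrt[where k = 19]) simp_all
  show "prime (379::nat)" by (rule prime_natI_sqrt[where k = 20]) simp_all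
  show "prime (757::nat)" by (rule prime_natI_sqrt[where k = 28]) simp_all
  show "prime (1093::nat)" by (rule prime_natI_sqrt[where k = 34]) simp_all
  show "prime (2179::nat)" by (rule prime_natI_sqrt[where k = 47]) simp_all
  show "prime (2801::nat)" by (rule prime_natI_sqrt[where k = 53]) simp_all
  show "prime (3541::nat)" by (rule prime_natI_sqrt[where k = 60]) simp_all
  show "prime (5419::nat)" by (rule prime_natI_sqrt[where k = 74]) simp_all
  show "prime (14281::nat)" by (rule prime_natI_sqrt[where k = 120]) simp_all
qed

section \<open>Prime factors of \<open>q ^ 3 - 1\<close>\<close>

lemma omega_cube_minus_1_explicit:
  fixes q :: nat
  assumes "q \<in> {15, 19, 23, 27, 31, 47, 51, 55, 59, 63, 119, 123, 127}"
  shows "2 ^ card (prime_factors (q ^ 3 - 1)) \<le> q"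
proof -
  have *: "2 ^ card (prime_factors (q ^ 3 - 1)) \<le> q"
    if "q ^ 3 - 1 = prod_list ps" "\<forall>p\<in>set ps. prime p" "2 ^ card (set ps) \<le> q" for ps
    using card_prime_factors_le[OF that(1,2)] that(3)
    by (meson one_le_numeral order.trans power_increasing)
  \<comment> \<open>The stored primes replace the evaluation of primality, which would be costly for
    the large factors.\<close>
  note [simp del] = prime_nat_numeral_eq and [simp] = small_primes large_primes
  \<comment> \<open>Values such as \<open>15\<close> and \<open>51\<close> are not prime powers;
    they occur because only the residue of \<open>q\<close> modulo \<open>4\<close> enters the
    estimate that produces this list.\<close>
  consider "q = 15" | "q = 19" | "q = 23" | "q = 27" | "q = 31" | "q = 47" | "q = 51" |
    "q = 55" | "q = 59" | "q = 63" | "q = 119" | "q = 123" | "q = 127"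
    using assms by blast
  thus ?thesis
  proof cases
    case 1
    thus ?thesis by (intro *[of "[2, 7, 241]"]) simp_all
  next
    case 2
    thus ?thesis by (intro *[of "[2, 3, 3, 3, 127]"]) simp_all
  next
    case 3
    thus ?thesis by (intro *[of "[2, 7, 11, 79]"]) simp_all
  next
    case 4
    thus ?thesis by (intro *[of "[2, 13, 757]"]) simp_all
  next
    case 5
    thus ?thesis by (intro *[of "[2, 3, 3, 5, 331]"]) simp_all
  next
    case 6
    thus ?thesis by (intro *[of "[2, 23, 37, 61]"]) simp_all
  next
    case 7
    thus ?thesis by (intro *[of "[2, 5, 5, 7, 379]"]) simp_all
  next
    case 8
    thus ?thesis by (intro *[of "[2, 3, 3, 3, 3, 13, 79]"]) simp_all
  next
    case 9
    thus ?thesis by (intro *[of "[2, 29, 3541]"]) simp_all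
  next
    case 10
    thus ?thesis by (intro *[of "[2, 31, 37, 109]"]) simp_all
  next
    case 11
    thus ?thesis by (intro *[of "[2, 59, 14281]"]) simp_all
  next
    case 12
    thus ?thesis by (intro *[of "[2, 7, 61, 2179]"]) simp_all
  next
    case 13
    thus ?thesis by (intro *[of "[2, 3, 3, 3, 7, 5419]"]) simp_all
  qed
qed

text \<open>If \<open>3\<close> divides \<open>q ^ 3 - 1\<close>, so does \<open>9\<close>; this gains the factor \<open>3\<close> in \<open>90090 = 3 * 30030\<close>. If not,
  the smallest possible primes are \<open>2, 5, 7, 11, 13, 17\<close>.\<close>

lemma rad_cube_minus_1_ge:
  fixes q :: nat
  assumes "q > 1"
  shows "90090 * 17 ^ card (prime_factors (q ^ 3 - 1)) \<le> (q ^ 3 - 1) * 17 ^ 6"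
proof -
  define m where "m = q ^ 3 - 1"
  define s where "s = card (prime_factors m)"
  have m: "m > 0" using assms power_strict_increasing[of 0 3 q] by (simp add: m_def)
  show ?thesis
  proof (cases "3 dvd m")
    case True
    have "9 dvd m"
    proof -
      have q3: "q ^ 3 = Suc m" using m by (simp add: m_def)
      have "q mod 3 = 1"
      proof -
        have "q ^ 3 mod 3 = 1" using True q3 by (auto elim!: dvdE)
        hence "(q mod 3) ^ 3 mod 3 = 1" by (simp add: power_mod)
        moreover have "q mod 3 = 0 \<or> q mod 3 = 1 \<or> q mod 3 = 2" by arith
        ultimately show ?thesis by (elim disjE) simp_all
      qed
      then obtain r where "q = 3 * r + 1" by (metis mult_div_mod_eq)
      hence "q ^ 3 = 9 * (3 * r ^ 3 + 3 * r ^ 2 + r) + 1"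
        by (simp add: power3_eq_cube power2_eq_square algebra_simps)
      thus ?thesis by (simp add: m_def)
    qed
    let ?P = "prime_factors m"
    have 3: "3 \<in> ?P" using True m by (auto simp: in_prime_factors_iff)
    have P: "\<Prod>?P = 3 * \<Prod>(?P - {3})" using 3 by (simp add: prod.remove)
    have "coprime 9 (\<Prod>(?P - {3}))"
    proof (rule prod_coprime_right)
      fix p assume p: "p \<in> ?P - {3}"
      have "coprime 3 p" using p by (intro primes_coprime) (auto simp: in_prime_factors_iff)
      hence "coprime (3 ^ 2) p" by (rule coprime_power_left_iff[THEN iffD2, OF disjI1])
      thus "coprime 9 p" by simp
    qed
    moreover have "\<Prod>(?P - {3}) dvd m" using prod_prime_factors_dvd[OF m] P by (metis dvd_mult_right)
    ultimately have "9 * \<Prod>(?P - {3}) dvd m" using \<open>9 dvd m\<close> by (intro divides_mult)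
    \<comment> \<open>The product of all prime factors contains \<open>3\<close> once, whereas
      \<open>m\<close> contains it at least twice.\<close>
    hence "3 * \<Prod>?P \<le> m" using m P by (auto dest: dvd_imp_le)
    moreover have "17 ^ s * 30030 \<le> \<Prod>?P * 17 ^ 6"
      using prime_factors_threshold_17[of "{2, 3, 5, 7, 11, 13}" m] by (simp add: s_def)
    ultimately show ?thesis unfolding m_def [symmetric] s_def [symmetric] by simp
  next
    case False
    \<comment> \<open>This suffices because \<open>90090 = 9 * 10010\<close> and
      \<open>9 \<le> 17\<close>.\<close>
    have "17 ^ s * 10010 \<le> \<Prod>(prime_factors m) * 17 ^ 5"
      using prime_factors_threshold_17[of "{2, 5, 7, 11, 13}" m] False by (fastforce simp: s_def)
    moreover have "\<Prod>(prime_factors m) \<le> m" using prod_prime_factors_dvd m by (simp add: dvd_imp_le)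
    ultimately show ?thesis unfolding m_def [symmetric] s_def [symmetric] by simp
  qed
qed

text \<open>This is the Moebius condition for \<open>n = 3\<close> and nonzero trace; it fails for
  the three excluded values. If \<open>q < 2 ^ s\<close>, the radical bound forces
  \<open>s \<le> 7\<close>, and each remaining \<open>s\<close> confines \<open>q\<close> to a short
  interval.\<close>

lemma omega_cube_minus_1:
  fixes q :: nat
  assumes "q mod 4 = 3" "q \<noteq> 3" "q \<noteq> 7" "q \<noteq> 11"
  shows "2 ^ card (prime_factors (q ^ 3 - 1)) \<le> q"
proof (rule ccontr)
  define s where "s = card (prime_factors (q ^ 3 - 1))"
  assume "\<not> ?thesis"
  hence less: "q < 2 ^ s" by (simp add: s_def)
  have q: "q \<ge> 15"
  proof (rule ccontr)
    assume "\<not> q \<ge> 15"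
    hence "q \<in> {..<15}" by simp
    thus False using assms by (auto simp: lessThan_nat_numeral)
  qed
  have rad: "90090 * 17 ^ s < q ^ 3 * 17 ^ 6"
    using rad_cube_minus_1_ge[of q] q power_strict_increasing[of 0 3 q]
    unfolding s_def by (simp add: diff_mult_distrib)
  have s7: "s \<le> 7"
  proof (rule ccontr)
    assume "\<not> s \<le> 7"
    then obtain k where s: "s = 8 + k" using le_Suc_ex[of 8 s] by auto
    have "q ^ 3 < (2 ^ s) ^ 3" using less by (intro power_strict_mono) auto
    also have "(2 ^ s) ^ 3 = (8 ^ s :: nat)" 
      using power_mult[of "2::nat" 3 s] power_mult[of "2::nat" s 3] by (simp add: mult.commute)
    finally have "q ^ 3 * 17 ^ 6 < 8 ^ s * (17 ^ 6 :: nat)" by (intro mult_strict_right_mono) auto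
    with rad have "90090 * 17 ^ s < 8 ^ s * (17 ^ 6 :: nat)" by (rule less_trans)
    moreover have "(8::nat) ^ k \<le> 17 ^ k" by (intro power_mono) auto
    ultimately show False by (simp add: s power_add)
  qed
  have up: "q < b" if "s \<le> j" "2 ^ j \<le> b" for b j
    using that less power_increasing[of s j "2::nat"] by linarith
  have low: "b < q" if "j \<le> s" "b ^ 3 * 17 ^ 6 \<le> 90090 * 17 ^ j" for b j
  proof (rule ccontr)
    assume "\<not> b < q"
    hence "q ^ 3 * 17 ^ 6 \<le> b ^ 3 * 17 ^ 6" by (intro mult_right_mono power_mono) auto
    also have "\<dots> \<le> 90090 * 17 ^ j" by (rule that)
    also have "\<dots> \<le> 90090 * 17 ^ s" using that(1) by (intro mult_left_mono power_increasing) auto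
    finally show False using rad by simp
  qed
  \<comment> \<open>The lower ends \<open>17\<close>, \<open>44\<close>, \<open>115\<close> are the
    integer parts of the cube roots of \<open>90090 * 17 ^ s / 17 ^ 6\<close> for
    \<open>s = 5, 6, 7\<close>.\<close>
  have "s \<le> 4 \<and> q < 16 \<or> s = 5 \<and> 17 < q \<and> q < 32 \<or> s = 6 \<and> 44 < q \<and> q < 64
     \<or> s = 7 \<and> 115 < q \<and> q < 128"
    using s7 up[of 4 16] up[of 5 32] up[of 6 64] up[of 7 128] low[of 5 17] low[of 6 44] low[of 7 115]
    by simp linarith
  hence "q \<in> {15, 19, 23, 27, 31, 47, 51, 55, 59, 63, 119, 123, 127}"
    using q assms(1) by simp presburger
  thus False using omega_cube_minus_1_explicit[of q] less by (simp add: s_def)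
qed

section \<open>Prime factors of \<open>q ^ n - 1\<close> and of its quotient by \<open>q - 1\<close>
  for \<open>n \<ge> 5\<close>\<close>

lemma small_power_cases:
  fixes q n :: nat
  assumes "q mod 4 = 3" "odd n" "n \<ge> 5" "q ^ (n - 1) < 4096 \<or> q ^ (n - 2) < 1024"
  shows "q = 3 \<and> n = 5 \<or> q = 3 \<and> n = 7 \<or> q = 7 \<and> n = 5"
proof -
  have mono: "a ^ b \<le> q ^ c" if "a \<le> q" "b \<le> c" "a \<ge> 1" for a b c
    using that power_mono[of a q b] power_increasing[of b c q] by linarith
  have "q < 11" using assms(3,4) mono[of 11 4 "n - 1"] mono[of 11 3 "n - 2"] by fastforce
  hence "q \<in> {..<11}" by simp
  hence q: "q = 3 \<or> q = 7" using assms(1) by (auto simp: lessThan_nat_numeral)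
  have "n < 7 \<or> q = 3 \<and> n < 9"
  proof (rule ccontr)
    assume *: "\<not> ?thesis"
    show False
    proof (cases "q = 3")
      case True
      hence "n \<ge> 9" using * by auto
      thus False using True assms(4) mono[of 3 8 "n - 1"] mono[of 3 7 "n - 2"] by fastforce
    next
      case False
      hence "q = 7" "n \<ge> 7" using q * by auto
      thus False using assms(4) mono[of 7 6 "n - 1"] mono[of 7 5 "n - 2"] by fastforce
    qed
  qed
  moreover have "n = 5 \<or> n = 7 \<or> n \<ge> 9" using assms(2,3) by presburger
  ultimately show ?thesis using q by auto
qed

text \<open>The radical bound, of order \<open>17 ^ s \<le> q ^ n\<close>, has to contradict
  \<open>q ^ (n - 1) < 4 ^ s\<close>. Since \<open>4 * n \<le> 5 * (n - 1)\<close>, fourth powers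
  make the exponents comparable, and \<open>17 ^ 4\<close> far exceeds \<open>4 ^ 5\<close>; this
  leaves \<open>s \<le> 6\<close>.\<close>

lemma omega_power_minus_1:
  fixes q n :: nat
  assumes "q mod 4 = 3" "odd n" "n \<ge> 5"
  shows "4 ^ card (prime_factors (q ^ n - 1)) \<le> q ^ (n - 1)"
proof (rule ccontr)
  define m where "m = q ^ n - 1"
  define s where "s = card (prime_factors m)"
  assume "\<not> ?thesis"
  hence less: "q ^ (n - 1) < 4 ^ s" by (simp add: s_def m_def)
  have q: "q \<ge> 3" using assms(1) by presburger
  have m: "m > 0" using q assms(3) power_strict_increasing[of 0 n q] by (simp add: m_def)
  have "17 ^ s * 30030 \<le> \<Prod>(prime_factors m) * 17 ^ 6"
    using prime_factors_threshold_17[of "{2, 3, 5, 7, 11, 13}" m] by (simp add: s_def)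
  also have "\<dots> \<le> q ^ n * 17 ^ 6"
    using dvd_imp_le[OF prod_prime_factors_dvd[OF m] m] by (simp add: m_def)
  finally have rad: "17 ^ s * 30030 \<le> q ^ n * 17 ^ 6" .
  have "s \<le> 6"
  proof (rule ccontr)
    assume "\<not> s \<le> 6"
    then obtain k where s: "s = 7 + k" using le_Suc_ex[of 7 s] by auto
    have "(17 ^ s * 30030) ^ 4 \<le> (q ^ n * 17 ^ 6) ^ 4" using rad by (intro power_mono) auto
    also have "\<dots> = q ^ (4 * n) * 17 ^ 24" by (simp add: power_mult_distrib mult.commute flip: power_mult)
    also have "q ^ (4 * n) \<le> q ^ (5 * (n - 1))"
      using q assms(3) by (intro power_increasing) auto
    also have "\<dots> = (q ^ (n - 1)) ^ 5" by (simp add: mult.commute flip: power_mult)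
    also have "\<dots> \<le> (4 ^ s) ^ 5" using less by (intro power_mono) auto
    also have "\<dots> = (1024 :: nat) ^ s"
      using power_mult[of "4::nat" 5 s] power_mult[of "4::nat" s 5] by (simp add: mult.commute)
    finally have "(17 ^ s * 30030) ^ 4 \<le> 1024 ^ s * (17 ^ 24 :: nat)" by simp
    moreover have "(17 ^ s * 30030) ^ 4 = 83521 ^ s * (30030 ^ 4 :: nat)"
      using power_mult[of "17::nat" 4 s] power_mult[of "17::nat" s 4]
      by (simp add: power_mult_distrib mult.commute)
    moreover have "(1024::nat) ^ k \<le> 83521 ^ k" "(83521::nat) ^ k > 0" by (auto intro: power_mono)
    ultimately show False by (simp add: s power_add)
  qed
  \<comment> \<open>\<open>4096 = 4 ^ 6\<close>, which leaves three pairs \<open>(q, n)\<close>; for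
    these the factorisations give \<open>s \<le> 3\<close>.\<close>
  hence "q ^ (n - 1) < 4096" using less power_increasing[of s 6 "4::nat"] by simp
  then consider "q = 3" "n = 5" | "q = 3" "n = 7" | "q = 7" "n = 5"
    using small_power_cases assms by blast
  hence "s \<le> 3"
  proof cases
    case 1
    thus ?thesis using card_prime_factors_le[of m "[2, 11, 11]"] by (simp add: s_def m_def)
  next
    case 2
    thus ?thesis
      using card_prime_factors_le[of m "[2, 1093]"] small_primes large_primes
      by (simp add: s_def m_def del: prime_nat_numeral_eq)
  next
    case 3
    thus ?thesis
      using card_prime_factors_le[of m "[2, 3, 2801]"] small_primes large_primes
      by (simp add: s_def m_def del: prime_nat_numeral_eq)
  qed
  hence "q ^ (n - 1) < 64" using less power_increasing[of s 3 "4::nat"] by simp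
  moreover have "3 ^ 4 \<le> q ^ (n - 1)"
    using q assms(3) power_mono[of 3 q 4] power_increasing[of 4 "n - 1" q] by linarith
  ultimately show False by simp
qed

text \<open>The analogue for trace zero, where the square root of the main term is smaller by a
  factor \<open>sqrt q\<close>. Oddness of \<open>Q\<close> removes \<open>2\<close> from the small
  primes, and cubes suffice because \<open>3 * (n - 1) \<le> 4 * (n - 2)\<close> and
  \<open>17 ^ 3\<close> exceeds \<open>4 ^ 4\<close>.\<close>

lemma omega_quotient:
  fixes q n Q :: nat
  assumes "q mod 4 = 3" "odd n" "n \<ge> 5" "(q - 1) * Q = q ^ n - 1" "odd Q"
  shows "4 ^ card (prime_factors Q) \<le> q ^ (n - 2)"
proof (rule ccontr)
  define s where "s = card (prime_factors Q)"
  assume "\<not> ?thesis"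
  hence less: "q ^ (n - 2) < 4 ^ s" by (simp add: s_def)
  have q: "q \<ge> 3" using assms(1) by presburger
  have Q: "Q > 0" using assms(5) by (auto intro: Nat.gr0I)
  have Q_le: "2 * Q \<le> 3 * q ^ (n - 1)"
  proof -
    have "2 * q \<le> 3 * (q - 1)" using q by simp
    hence "2 * q * Q \<le> 3 * (q - 1) * Q" by (rule mult_right_mono) simp
    hence "q * (2 * Q) \<le> 3 * ((q - 1) * Q)" by (simp only: ac_simps)
    also have "\<dots> \<le> 3 * q ^ n" using assms(4) by simp
    also have "\<dots> = q * (3 * q ^ (n - 1))" using assms(3) by (simp flip: power_Suc)
    finally show ?thesis using q by simp
  qed
  have "17 ^ s * 15015 \<le> \<Prod>(prime_factors Q) * 17 ^ 5"
    using prime_factors_threshold_17[of "{3, 5, 7, 11, 13}" Q] assms(5) by (fastforce simp: s_def)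
  also have "\<dots> \<le> Q * 17 ^ 5"
    using dvd_imp_le[OF prod_prime_factors_dvd[OF Q] Q] by simp
  finally have rad: "17 ^ s * 30030 \<le> 3 * q ^ (n - 1) * 17 ^ 5"
    using mult_right_mono[OF Q_le, of "17 ^ 5"] by simp
  have "s \<le> 5"
  proof (rule ccontr)
    assume "\<not> s \<le> 5"
    then obtain k where s: "s = 6 + k" using le_Suc_ex[of 6 s] by auto
    have "(17 ^ s * 30030) ^ 3 \<le> (3 * q ^ (n - 1) * 17 ^ 5) ^ 3" using rad by (intro power_mono) auto
    also have "\<dots> = q ^ (3 * (n - 1)) * (27 * 17 ^ 15)"
      by (simp add: power_mult_distrib mult.commute flip: power_mult)
    also have "q ^ (3 * (n - 1)) \<le> q ^ (4 * (n - 2))"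
      using q assms(3) by (intro power_increasing) auto
    also have "\<dots> = (q ^ (n - 2)) ^ 4" by (simp add: mult.commute flip: power_mult)
    also have "\<dots> \<le> (4 ^ s) ^ 4" using less by (intro power_mono) auto
    also have "\<dots> = (256 :: nat) ^ s"
      using power_mult[of "4::nat" 4 s] power_mult[of "4::nat" s 4] by (simp add: mult.commute)
    finally have "(17 ^ s * 30030) ^ 3 \<le> 256 ^ s * (27 * 17 ^ 15 :: nat)" by simp
    moreover have "(17 ^ s * 30030) ^ 3 = 4913 ^ s * (30030 ^ 3 :: nat)"
      using power_mult[of "17::nat" 3 s] power_mult[of "17::nat" s 3]
      by (simp add: power_mult_distrib mult.commute)
    moreover have "(256::nat) ^ k \<le> 4913 ^ k" "(4913::nat) ^ k > 0" by (auto intro: power_mono)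
    ultimately show False by (simp add: s power_add)
  qed
  hence "q ^ (n - 2) < 1024" using less power_increasing[of s 5 "4::nat"] by simp
  then consider "q = 3" "n = 5" | "q = 3" "n = 7" | "q = 7" "n = 5"
    using small_power_cases assms by blast
  hence "s \<le> 1"
  proof cases
    case 1
    thus ?thesis using card_prime_factors_le[of Q "[11, 11]"] assms(4) by (simp add: s_def)
  next
    case 2
    thus ?thesis
      using card_prime_factors_le[of Q "[1093]"] large_primes assms(4)
      by (simp add: s_def del: prime_nat_numeral_eq)
  next
    case 3
    thus ?thesis
      using card_prime_factors_le[of Q "[2801]"] large_primes assms(4)
      by (simp add: s_def del: prime_nat_numeral_eq)
  qed
  hence "q ^ (n - 2) < 4 ^ 1" using less power_increasing[of s 1 "4::nat"] by simp
  moreover have "3 ^ 3 \<le> q ^ (n - 2)"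
    using q assms(3) power_mono[of 3 q 3] power_increasing[of 3 "n - 2" q] by linarith
  ultimately show False by simp
qed

section \<open>Prime divisors of \<open>q ^ 2 + q + 1\<close>\<close>

lemma prime_dvd_quadratic:
  fixes p q :: nat
  assumes "prime p" "p dvd q ^ 2 + q + 1"
  shows "p \<in> {3, 7, 13, 19} \<or> 31 \<le> p"
proof -
  \<comment> \<open>Conceptually, for \<open>p \<noteq> 3\<close> the residue of \<open>q\<close>
    has order \<open>3\<close> modulo \<open>p\<close>, so \<open>p\<close> is \<open>1\<close>
    modulo \<open>3\<close>. Below \<open>31\<close> it is enough to test all residues.\<close>
  have "\<forall>p\<in>set [2..<31]. (\<exists>d\<in>set [2..<p]. d dvd p) \<or> p \<in> {3, 7, 13, 19}
      \<or> (\<forall>r\<in>set [0..<p]. (r * r + r + 1) mod p \<noteq> (0::nat))"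
    by code_simp
  moreover have "\<not> d dvd p" if "d \<in> set [2..<p]" for d
    using assms(1) that by (auto simp: prime_nat_iff)
  moreover have "((q mod p) * (q mod p) + q mod p + 1) mod p = 0"
  proof -
    have "((q mod p) * (q mod p) + q mod p + 1) mod p = (q * q + q + 1) mod p"
      by (intro mod_add_cong mod_mult_cong mod_mod_trivial refl)
    thus ?thesis using assms(2) by (simp add: power2_eq_square)
  qed
  moreover have "q mod p \<in> set [0..<p]" "p \<ge> 2"
    using assms(1) prime_ge_2_nat prime_gt_0_nat by auto
  ultimately show ?thesis by (metis atLeastLessThan_iff not_le set_upt)
qed

text \<open>Replaces the square root of \<open>q\<close> by a rational lower bound \<open>y\<close>
  and the reciprocal sum by an upper bound \<open>c\<close>, so that the union criterion becomes
  rational arithmetic.\<close>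

lemma union_sieve_inequality:
  fixes q s \<sigma> c y :: real
  assumes "1 \<le> y" "y\<^sup>2 \<le> q" "\<sigma> \<le> c" "c < 1" "s + (y - 1) * c \<le> y"
  shows "(q + 1) * \<sigma> + (s - \<sigma>) * sqrt q < q + 1"
proof -
  have q: "q \<ge> 0" using assms(2) by (smt (verit) zero_le_power2)
  have "y \<le> sqrt q" using assms(1,2) by (intro real_le_rsqrt)
  hence yq: "y * sqrt q \<le> q"
    using mult_right_mono[of y "sqrt q" "sqrt q"] q by simp
  have "(y - 1) * \<sigma> \<le> (y - 1) * c" using assms by (intro mult_left_mono) auto
  hence "s - \<sigma> \<le> (1 - \<sigma>) * y" using assms(5) by (simp add: algebra_simps)
  hence "(s - \<sigma>) * sqrt q \<le> (1 - \<sigma>) * y * sqrt q" using q by (intro mult_right_mono) auto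
  also have "\<dots> = (1 - \<sigma>) * (y * sqrt q)" by simp
  also have "\<dots> \<le> (1 - \<sigma>) * q" using yq assms(3,4) by (intro mult_left_mono) auto
  also have "\<dots> < (1 - \<sigma>) * (q + 1)" using assms(3,4) by (intro mult_strict_left_mono) auto
  finally show ?thesis by (simp add: algebra_simps)
qed

text \<open>The alternatives are the two sieve conditions for \<open>n = 3\<close> and trace zero,
  divided by \<open>q - 1\<close>. Moebius inversion serves \<open>s \<ge> 10\<close>, and
  \<open>s \<le> 3\<close> with \<open>q < 31\<close>; the union bound serves the rest.\<close>

lemma omega_quadratic:
  fixes q :: nat
  assumes "q mod 4 = 3"
  defines "P \<equiv> prime_factors (q ^ 2 + q + 1)"
  shows "(2 ^ card P - 1) * sqrt q < real q + 1 \<or>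
    (real q + 1) * (\<Sum>p\<in>P. 1 / real p) + (card P - (\<Sum>p\<in>P. 1 / real p)) * sqrt q < real q + 1"
    (is "?moebius \<or> ?union")
proof -
  define s where "s = card P"
  have P: "p \<in> {3, 7, 13, 19} \<or> 31 \<le> p" if "p \<in> P" for p
    using that prime_dvd_quadratic[of p q] by (auto simp: P_def in_prime_factors_iff)
  have fin: "finite P" by (simp add: P_def)
  have moebius: ?moebius if "(2 ^ s - 1) ^ 2 * real q < (real q + 1) ^ 2"
  proof -
    have "((2 ^ s - 1) * sqrt q) ^ 2 < (real q + 1) ^ 2"
      using that by (simp add: power_mult_distrib)
    thus ?thesis unfolding s_def by (rule power_less_imp_less_base) simp
  qed
  show ?thesis
  proof (cases "s \<ge> 4")
    case True
    then obtain k where s: "s = 4 + k" using le_Suc_ex by blast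
    have "31 ^ s * 5187 \<le> \<Prod>P * 31 ^ 4"
      using prod_ge_threshold[OF fin, of "{3, 7, 13, 19}" 31] P by (fastforce simp: s_def)
    also have "\<dots> \<le> (q ^ 2 + q + 1) * 31 ^ 4"
      unfolding P_def by (intro mult_right_mono dvd_imp_le[OF prod_prime_factors_dvd]) auto
    finally have rad: "31 ^ k * 5187 \<le> q ^ 2 + q + 1" by (simp add: s power_add)
    \<comment> \<open>This is roughly the square root of \<open>rad\<close>: \<open>75 ^ 2\<close>
      is near \<open>5187\<close>, and \<open>25 < 31\<close> gives room for every
      \<open>k \<ge> 1\<close>.\<close>
    have q_ge: "75 * 5 ^ k \<le> q"
    proof (rule ccontr)
      assume less: "\<not> 75 * 5 ^ k \<le> q"
      show False
      proof (cases k)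
        case 0
        \<comment> \<open>The residue modulo \<open>4\<close> is essential here:
          \<open>q = 72\<close> would satisfy \<open>rad\<close>, while
          \<open>71 ^ 2 + 71 + 1 = 5113\<close> is below \<open>5187\<close>.\<close>
        hence "q \<le> 71" using less assms(1) by simp presburger
        hence "q ^ 2 \<le> 71 ^ 2" by (intro power_mono) auto
        thus False using rad 0 \<open>q \<le> 71\<close> by simp
      next
        case (Suc j)
        have "q ^ 2 + q + 1 \<le> (q + 1) ^ 2" by (simp add: power2_eq_square)
        also have "\<dots> \<le> (75 * 5 ^ k) ^ 2" using less by (intro power_mono) auto
        also have "\<dots> = 5625 * 25 ^ k"
          using power_mult[of "5::nat" 2 k] power_mult[of "5::nat" k 2]
          by (simp add: power_mult_distrib mult.commute)
        finally have "31 ^ k * 5187 \<le> 5625 * (25::nat) ^ k" using rad by linarith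
        moreover have "(25::nat) ^ j \<le> 31 ^ j" "(31::nat) ^ j > 0" by (auto intro: power_mono)
        ultimately show False by (simp add: Suc)
      qed
    qed
    show ?thesis
    \<comment> \<open>\<open>k = 6\<close> is the first value with
      \<open>4 ^ (4 + k) \<le> 75 * 5 ^ k\<close>.\<close>
    proof (cases "k \<ge> 6")
      case True
      then obtain j where k: "k = 6 + j" using le_Suc_ex by blast
      have "(4::nat) ^ j \<le> 5 ^ j" by (intro power_mono) auto
      hence "(4::nat) ^ s \<le> 75 * 5 ^ k" by (simp add: s k power_add)
      hence "4 ^ s \<le> q" using q_ge by linarith
      hence "real (4 ^ s) \<le> real q" by (simp only: of_nat_le_iff)
      hence le: "4 ^ s \<le> real q" by simp
      have "(2 ^ s - 1) ^ 2 * real q \<le> (2 ^ s) ^ 2 * real q"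
        by (intro mult_right_mono power_mono) auto
      also have "(2 ^ s) ^ 2 = (4 ^ s :: real)"
        using power_mult[of "2::real" 2 s] power_mult[of "2::real" s 2] by (simp add: mult.commute)
      also have "4 ^ s * real q \<le> real q * real q" using le by (intro mult_right_mono) auto
      also have "\<dots> < (real q + 1) ^ 2" by (simp add: power2_eq_square algebra_simps)
      finally show ?thesis using moebius by blast
    next
      case False
      \<comment> \<open>\<open>173 / 20\<close> lies just below the square root of \<open>75\<close>, the least admissible \<open>q\<close> for \<open>k = 0\<close>.\<close>
      define c where "c = 1 / 3 + 1 / 7 + 1 / 13 + 1 / 19 + real k / 31"
      have "(\<Sum>p\<in>P. 1 / real p) \<le> c"
        using sum_inverse_le_threshold[OF fin, of "{3, 7, 13, 19}" 31] P s
        by (fastforce simp: s_def c_def)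
      moreover have "(173 / 20 * 2 ^ k)\<^sup>2 \<le> real q"
      proof -
        have "(173 / 20 * 2 ^ k)\<^sup>2 = 29929 / 400 * (4 ^ k :: real)"
          using power_mult[of "2::real" 2 k] power_mult[of "2::real" k 2]
          by (simp add: power_mult_distrib mult.commute power2_eq_square)
        also have "\<dots> \<le> 75 * 5 ^ k" by (intro mult_mono power_mono) auto
        also have "\<dots> = real (75 * 5 ^ k)" by simp
        also have "\<dots> \<le> real q" using q_ge by (simp only: of_nat_le_iff)
        finally show ?thesis .
      qed
      moreover have "k = 0 \<or> k = 1 \<or> k = 2 \<or> k = 3 \<or> k = 4 \<or> k = 5" using False by auto
      hence "c < 1" "real s + (173 / 20 * 2 ^ k - 1) * c \<le> 173 / 20 * 2 ^ k"
        by (auto simp: c_def s)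
      moreover have "1 \<le> 173 / 20 * (2 ^ k :: real)"
        using one_le_power[of "2::real" k] by linarith
      ultimately have "(real q + 1) * (\<Sum>p\<in>P. 1 / real p)
          + (real s - (\<Sum>p\<in>P. 1 / real p)) * sqrt q < real q + 1"
        by (intro union_sieve_inequality)
      thus ?thesis by (simp add: s_def)
    qed
  next
    case s3: False
    show ?thesis
    proof (cases "q \<ge> 31")
      case True
      have "(\<Sum>p\<in>P. 1 / real p) \<le> 1 / 3 + 1 / 7 + (real s - 2) / 13"
        using sum_inverse_le_threshold[OF fin, of "{3, 7}" 13] P by (fastforce simp: s_def)
      also have "\<dots> \<le> 1 / 3 + 1 / 7 + 1 / 13" using s3 by (intro add_left_mono) simp
      finally have "(\<Sum>p\<in>P. 1 / real p) \<le> 1 / 3 + 1 / 7 + 1 / 13" .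
      \<comment> \<open>\<open>11 / 2\<close> lies just below the square root of \<open>31\<close>;
        the required inequality is nearly sharp for \<open>s = 3\<close>.\<close>
      hence "(real q + 1) * (\<Sum>p\<in>P. 1 / real p)
          + (real s - (\<Sum>p\<in>P. 1 / real p)) * sqrt q < real q + 1"
        using True s3
        by (intro union_sieve_inequality[where y = "11 / 2" and c = "1 / 3 + 1 / 7 + 1 / 13"])
           (auto simp: power2_eq_square)
      thus ?thesis by (simp add: s_def)
    next
      case False
      hence "q \<in> {..<31}" by simp
      hence "q = 3 \<or> q = 7 \<or> q = 11 \<or> q = 15 \<or> q = 19 \<or> q = 23 \<or> q = 27"
        using assms(1) by (auto simp: lessThan_nat_numeral)
      moreover have "s \<le> card (set ps)" if "q ^ 2 + q + 1 = prod_list ps" "\<forall>p\<in>set ps. prime p" for ps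
        using card_prime_factors_le[OF that] by (simp add: s_def P_def)
      \<comment> \<open>The lists factorise \<open>q ^ 2 + q + 1\<close> for
        \<open>q = 3, 7, 11, 15, 19, 23, 27\<close> in this order.\<close>
      note this[of "[13]"] this[of "[3, 19]"] this[of "[7, 19]"] this[of "[241]"]
        this[of "[3, 127]"] this[of "[7, 79]"] this[of "[757]"]
      ultimately have s: "s \<le> 1 \<or> s \<le> 2 \<and> q \<ge> 7"
        using small_primes large_primes
        by (elim disjE) (simp_all del: prime_nat_numeral_eq)
      have "(2 ^ s - 1) ^ 2 * real q < (real q + 1) ^ 2"
      proof (cases "s \<le> 1")
        case True
        hence "s = 0 \<or> s = 1" by auto
        thus ?thesis by (auto simp: power2_eq_square algebra_simps add_pos_nonneg)
      next
        case False
        hence "s = 2" "q \<ge> 7" using s by auto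
        have "7 * real q \<le> real q * real q" using \<open>q \<ge> 7\<close> by (intro mult_right_mono) auto
        thus ?thesis using \<open>s = 2\<close> by (simp add: power2_eq_square algebra_simps)
      qed
      thus ?thesis using moebius by blast
    qed
  qed
qed

section \<open>Traces and characters of finite fields\<close>

lemma coprime_iff_prime_factors:
  fixes i N :: nat
  assumes "N > 0"
  shows "coprime i N \<longleftrightarrow> (\<forall>p\<in>prime_factors N. \<not> p dvd i)"
proof
  assume "coprime i N"
  thus "\<forall>p\<in>prime_factors N. \<not> p dvd i"
    by (metis in_prime_factors_iff not_coprimeI not_prime_unit)
next
  assume "\<forall>p\<in>prime_factors N. \<not> p dvd i"
  hence "\<not> p dvd gcd i N" if "prime p" for p
    using assms that by (auto simp: in_prime_factors_iff)
  thus "coprime i N"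
    unfolding coprime_iff_gcd_eq_1 by (metis prime_factor_nat)
qed

text \<open>Let \<open>t\<close> be the product of the primes of \<open>N\<close> that do not divide
  \<open>i\<close>. A prime of \<open>N\<close> then divides exactly one of \<open>i\<close> and
  \<open>Q * t\<close>, hence not their sum.\<close>

lemma exists_coprime_add_mult:
  fixes i Q N :: nat
  assumes "coprime i Q" "N > 0"
  obtains t where "coprime (i + Q * t) N"
proof -
  define t where "t = \<Prod>{p\<in>prime_factors N. \<not> p dvd i}"
  have "\<not> p dvd i + Q * t" if p: "prime p" "p dvd N" for p
  proof (cases "p dvd i")
    case True
    hence "\<not> p dvd Q" using assms(1) p(1) by (meson not_coprimeI not_prime_unit)
    moreover have "\<not> p dvd t"
    proof
      assume "p dvd t"
      then obtain r where r: "r \<in> prime_factors N" "\<not> r dvd i" "p dvd r"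
        using p(1) by (auto simp: t_def prime_dvd_prod_iff)
      hence "p = r" using p(1) by (metis in_prime_factors_imp_prime primes_dvd_imp_eq)
      thus False using r True by simp
    qed
    ultimately show ?thesis using True p(1) by (simp add: dvd_add_right_iff prime_dvd_mult_iff)
  next
    case False
    hence "p \<in> {p\<in>prime_factors N. \<not> p dvd i}"
      using p assms(2) by (auto simp: in_prime_factors_iff)
    hence "p dvd t" unfolding t_def by (intro dvd_prodI) auto
    thus ?thesis using False by (simp add: dvd_add_left_iff)
  qed
  hence "coprime (i + Q * t) N"
    using assms(2) by (auto simp: coprime_iff_prime_factors in_prime_factors_iff)
  thus ?thesis by (rule that)
qed

text \<open>Multiplication by \<open>x\<close> permutes \<open>H\<close>; comparing the products
  over \<open>H\<close> gives the claim. This serves both the subfield and the whole field.\<close>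

lemma power_card_mult_closed:
  fixes H :: "'a::field set"
  assumes "finite H" "0 \<notin> H" "\<And>y z. y \<in> H \<Longrightarrow> z \<in> H \<Longrightarrow> y * z \<in> H" "x \<in> H"
  shows "x ^ card H = 1"
proof -
  have x: "x \<noteq> 0" using assms by auto
  have inj: "inj_on ((*) x) H" using x by (auto simp: inj_on_def)
  have "(*) x ` H = H"
    using assms inj by (intro endo_inj_surj) auto
  hence "(\<Prod>y\<in>H. y) = (\<Prod>y\<in>H. x * y)"
    using prod.reindex[OF inj, of "\<lambda>y. y"] by simp
  also have "\<dots> = x ^ card H * (\<Prod>y\<in>H. y)"
    by (simp add: prod.distrib)
  finally show ?thesis using assms(1,2) by (simp add: prod_zero_iff)
qed

section \<open>Generator of the multiplicative group and multiplicative characters\<close>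

lemma finite_field_generator:
  obtains g :: "'a::{field,finite}" where "bij_betw (\<lambda>i. g ^ i) {..<CARD('a) - 1} (UNIV - {0})"
    and "g ^ (CARD('a) - 1) = 1" and "g \<noteq> 0"
proof -
  \<comment> \<open>The type is repackaged as a ring record so that cyclicity of the multiplicative
    group of a finite field applies.\<close>
  let ?R = "\<lparr>carrier = UNIV, mult = (*), one = 1, zero = 0, add = (+)\<rparr> :: 'a ring"
  have "\<exists>y. x + y = 0" for x :: 'a
    using add.right_inverse by blast
  moreover have "x \<noteq> 0 \<Longrightarrow> \<exists>y. x * y = 1" for x :: 'a
    by (rule exI[of _ "inverse x"]) auto
  ultimately interpret R: field ?R
    using add.right_inverse by unfold_locales (auto simp: algebra_simps Units_def)
  have pow: "a [^]\<^bsub>?R\<^esub> (i::nat) = a ^ i" for a i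
    by (induction i) (simp_all add: nat_pow_def)
  have car: "carrier (mult_of ?R) = UNIV - {0}"
    by (simp add: carrier_mult_of)
  obtain g where "g \<in> UNIV - {0}" and "UNIV - {0} = {g [^]\<^bsub>?R\<^esub> i | i::nat. i \<in> UNIV}"
    using R.finite_field_mult_group_has_gen[unfolded car] by (elim meta_impE bexE) (simp, rule that)
  hence g: "g \<noteq> 0" and gen: "UNIV - {0} = {g ^ i | i::nat. i \<in> UNIV}"
    unfolding pow by auto
  let ?N = "CARD('a) - 1"
  have cardN: "card (UNIV - {0 :: 'a}) = ?N" by (simp add: card_Diff_subset)
  have one: "g ^ ?N = 1"
    using power_card_mult_closed[of "UNIV - {0 :: 'a}" g] g by (simp add: cardN)
  have N: "?N > 0"
    using cardN card_gt_0_iff[of "UNIV - {0 :: 'a}"] g by fastforce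
  have "(\<lambda>i. g ^ i) ` {..<?N} = UNIV - {0}"
  proof
    show "(\<lambda>i. g ^ i) ` {..<?N} \<subseteq> UNIV - {0}" using g by auto
    show "UNIV - {0} \<subseteq> (\<lambda>i. g ^ i) ` {..<?N}"
    proof
      fix x assume "x \<in> UNIV - {0 :: 'a}"
      then obtain i where "x = g ^ i" using gen by blast
      also have "g ^ i = g ^ (?N * (i div ?N) + i mod ?N)" by simp
      also have "\<dots> = g ^ (i mod ?N)" by (simp only: power_add power_mult one) simp
      finally show "x \<in> (\<lambda>i. g ^ i) ` {..<?N}" using N by auto
    qed
  qed
  moreover from this have "inj_on (\<lambda>i. g ^ i) {..<?N}"
    by (intro eq_card_imp_inj_on) (simp_all add: cardN)
  ultimately show ?thesis using that one g by (auto simp: bij_betw_def)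
qed

text \<open>In the product of the sum with its conjugate, substitute \<open>x = t * y\<close>: the
  term becomes \<open>\<chi> t\<close>, weighted by the autocorrelation of \<open>D\<close> at
  \<open>t\<close>.\<close>

lemma norm_sum_multiplicative_squared:
  fixes \<chi> :: "'a::{field,finite} \<Rightarrow> complex" and D :: "'a set"
  assumes mult: "\<And>x y. x \<noteq> 0 \<Longrightarrow> y \<noteq> 0 \<Longrightarrow> \<chi> (x * y) = \<chi> x * \<chi> y"
    and norm1: "\<And>x. x \<noteq> 0 \<Longrightarrow> norm (\<chi> x) = 1" and D: "0 \<notin> D"
  shows "of_real ((norm (\<Sum>x\<in>D. \<chi> x))\<^sup>2)
           = (\<Sum>t\<in>UNIV - {0}. of_nat (card {y\<in>D. t * y \<in> D}) * \<chi> t)"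
proof -
  have "of_real ((norm (\<Sum>x\<in>D. \<chi> x))\<^sup>2) = (\<Sum>x\<in>D. \<chi> x) * cnj (\<Sum>x\<in>D. \<chi> x)"
    by (rule complex_norm_square)
  also have "\<dots> = (\<Sum>y\<in>D. \<Sum>x\<in>D. \<chi> x * cnj (\<chi> y))"
    by (subst sum.swap) (simp add: sum_product)
  also have "\<dots> = (\<Sum>y\<in>D. \<Sum>t\<in>UNIV - {0}. if t * y \<in> D then \<chi> t else 0)"
  proof (rule sum.cong[OF refl])
    fix y assume "y \<in> D"
    hence y: "y \<noteq> 0" using D by auto
    have "(\<Sum>x\<in>D. \<chi> x * cnj (\<chi> y)) = (\<Sum>t\<in>{t\<in>UNIV - {0}. t * y \<in> D}. \<chi> t)"
    proof (rule sum.reindex_bij_witness[of _ "\<lambda>t. t * y" "\<lambda>x. x / y"])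
      fix x assume "x \<in> D"
      hence x: "x \<noteq> 0" using D by auto
      have "\<chi> x = \<chi> (x / y) * \<chi> y" using x y mult[of "x / y" y] by simp
      moreover have "\<chi> y * cnj (\<chi> y) = 1"
        using norm1[OF y] by (simp flip: complex_norm_square)
      ultimately show "\<chi> (x / y) = \<chi> x * cnj (\<chi> y)" by (simp add: mult.assoc)
    qed (use y D in auto)
    thus "(\<Sum>x\<in>D. \<chi> x * cnj (\<chi> y)) = (\<Sum>t\<in>UNIV - {0}. if t * y \<in> D then \<chi> t else 0)"
      by (simp flip: sum.inter_filter)
  qed
  also have "\<dots> = (\<Sum>t\<in>UNIV - {0}. of_nat (card {y\<in>D. t * y \<in> D}) * \<chi> t)"
    by (subst sum.swap) (simp flip: sum.inter_filter)
  finally show ?thesis .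
qed

section \<open>Frobenius and the subfield\<close>

locale subfield_of_finite_field =
  fixes F :: "'a::{field,finite} set" and q n :: nat
  assumes primepow_q: "primepow q" and n_ge_2: "n \<ge> 2"
    and card_UNIV: "CARD('a) = q ^ n"
    and subfield: "is_subfield F" and card_F: "card F = q"
begin

abbreviation Tr :: "'a \<Rightarrow> 'a" where "Tr \<equiv> field_trace q n"

lemma q_ge_2: "q \<ge> 2"
  using primepow_gt_Suc_0[OF primepow_q] by simp

lemma subfieldD:
  "0 \<in> F" "1 \<in> F" "x \<in> F \<Longrightarrow> y \<in> F \<Longrightarrow> x - y \<in> F" "x \<in> F \<Longrightarrow> y \<in> F \<Longrightarrow> x * y \<in> F"
  "x \<in> F \<Longrightarrow> inverse x \<in> F"
  using subfield by (auto simp: is_subfield_def)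

lemma subfield_uminus: "x \<in> F \<Longrightarrow> - x \<in> F"
  using subfieldD(3)[of 0 x] subfieldD(1) by simp

lemma subfield_divide: "x \<in> F \<Longrightarrow> y \<in> F \<Longrightarrow> x / y \<in> F"
  by (simp add: divide_inverse subfieldD)

text \<open>The characteristic divides the field size, so it is the prime of which \<open>q\<close>
  is a power.\<close>

lemma freshman: "(x + y :: 'a) ^ (q ^ i) = x ^ (q ^ i) + y ^ (q ^ i)"
proof -
  obtain r k where rk: "prime r" "k > 0" "q = r ^ k"
    using primepow_q by (auto simp: primepow_def)
  have pr: "prime CHAR('a)"
    using finite_imp_CHAR_pos[where ?'a = 'a] prime_CHAR_semidom[where ?'a = 'a] by simp
  have "CHAR('a) dvd r ^ (k * n)"
    using CHAR_dvd_CARD[where ?'a = 'a] card_UNIV rk by (simp add: power_mult)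
  hence "CHAR('a) = r"
    using pr rk(1) by (metis prime_dvd_power primes_dvd_imp_eq)
  hence "q ^ i = CHAR('a) ^ (k * i)" using rk by (simp add: power_mult)
  thus ?thesis using pr by (rule_tac freshmans_dream') auto
qed

lemma power_q_subfield: "x \<in> F \<Longrightarrow> x ^ q = x"
proof (cases "x = 0")
  case False
  assume "x \<in> F"
  have "x ^ card (F - {0}) = 1"
    using False \<open>x \<in> F\<close> by (intro power_card_mult_closed) (auto intro: subfieldD)
  moreover have "card (F - {0}) = q - 1"
    using card_F subfieldD(1) by (simp add: card_Diff_subset)
  ultimately have "x ^ Suc (q - 1) = x" by simp
  thus ?thesis using q_ge_2 by simp
qed (use q_ge_2 in auto)

lemma power_q_power_subfield: "x \<in> F \<Longrightarrow> x ^ (q ^ i) = x"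
  by (induction i) (simp_all add: power_mult power_q_subfield)

lemma power_card_UNIV: "(x::'a) ^ (q ^ n) = x"
proof (cases "x = 0")
  case False
  have "x ^ card (UNIV - {0::'a}) = 1"
    using False by (intro power_card_mult_closed) auto
  moreover have "card (UNIV - {0::'a}) = q ^ n - 1"
    by (simp add: card_Diff_subset card_UNIV)
  ultimately have "x ^ Suc (q ^ n - 1) = x" by simp
  thus ?thesis using q_ge_2 by simp
qed (use q_ge_2 in auto)

text \<open>The polynomial \<open>X ^ q - X\<close> vanishes on the \<open>q\<close> elements of
  \<open>F\<close> and has at most \<open>q\<close> roots.\<close>

lemma subfield_iff: "x \<in> F \<longleftrightarrow> x ^ q = x"
proof -
  let ?p = "monom 1 q - monom 1 1 :: 'a poly"
  have "coeff ?p q = 1" using q_ge_2 by simp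
  hence "?p \<noteq> 0" by (metis coeff_0 zero_neq_one)
  hence "card {x. poly ?p x = 0} \<le> degree ?p" by (rule card_poly_roots_bound)
  also have "\<dots> \<le> q" using q_ge_2
    by (intro degree_diff_le degree_monom_le order.trans[OF degree_monom_le]) auto
  also have "{x. poly ?p x = 0} = {x. x ^ q = x}" by (simp add: poly_monom)
  finally have "F = {x. x ^ q = x}"
    using power_q_subfield card_F by (intro card_seteq) auto
  thus ?thesis by blast
qed

section \<open>Linearity, values and fibres of the trace\<close>

lemma Tr_add: "Tr (x + y) = Tr x + Tr y"
  by (simp add: field_trace_def freshman sum.distrib)

lemma Tr_scale: "c \<in> F \<Longrightarrow> Tr (c * x) = c * Tr x"
  by (simp add: field_trace_def power_mult_distrib power_q_power_subfield sum_distrib_left)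

lemma Tr_0 [simp]: "Tr 0 = 0"
  using Tr_scale[of 0 0] subfieldD(1) by simp

lemma Tr_uminus: "Tr (- x) = - Tr x"
  using Tr_add[of x "- x"] by (simp add: eq_neg_iff_add_eq_0 add.commute)

lemma Tr_diff: "Tr (x - y) = Tr x - Tr y"
  using Tr_add[of x "- y"] by (simp add: Tr_uminus)

lemma Tr_in: "Tr x \<in> F"
proof -
  have sum_q: "(\<Sum>i\<in>A. f i) ^ q = (\<Sum>i\<in>A. f i ^ q)" if "finite A"
    for A :: "nat set" and f :: "nat \<Rightarrow> 'a"
    using that q_ge_2
    by (induction A rule: finite_induct) (use freshman[where i = 1] in auto)
  \<comment> \<open>Raising to the power \<open>q\<close> shifts the summands cyclically, because
    \<open>x ^ (q ^ n) = x\<close>.\<close>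
  have "Tr x ^ q = (\<Sum>i<n. x ^ (q ^ Suc i))"
    by (simp add: field_trace_def sum_q mult.commute flip: power_mult)
  also have "\<dots> = Tr x + x ^ (q ^ n) - x ^ (q ^ 0)"
    using sum.lessThan_Suc[of "\<lambda>i. x ^ (q ^ i)" n]
      sum.lessThan_Suc_shift[of "\<lambda>i. x ^ (q ^ i)" n]
    by (simp add: field_trace_def algebra_simps)
  finally show ?thesis by (simp add: subfield_iff power_card_UNIV)
qed

text \<open>As a polynomial the trace has degree at most \<open>q ^ (n - 1)\<close>, too small to
  vanish on the whole field; a nonzero value is then scaled to \<open>1\<close>.\<close>

lemma Tr_eq_1: obtains x where "Tr x = 1"
proof -
  let ?p = "\<Sum>i<n. monom 1 (q ^ i) :: 'a poly"
  have "coeff ?p (q ^ (n - 1)) = (\<Sum>i<n. if i = n - 1 then 1 else 0)"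
    unfolding coeff_sum coeff_monom using q_ge_2
    by (intro sum.cong refl if_cong) (auto simp: power_inject_exp)
  also have "\<dots> = 1" using n_ge_2 by simp
  finally have "?p \<noteq> 0" by (metis coeff_0 zero_neq_one)
  hence "card {x. poly ?p x = 0} \<le> degree ?p" by (rule card_poly_roots_bound)
  also have "\<dots> \<le> q ^ (n - 1)" using q_ge_2
    by (intro degree_sum_le order.trans[OF degree_monom_le] power_increasing) auto
  also have "\<dots> < q ^ n" using q_ge_2 n_ge_2 by (intro power_strict_increasing) auto
  also have "{x. poly ?p x = 0} = {x. Tr x = 0}" by (simp add: poly_sum poly_monom field_trace_def)
  finally have "{x. Tr x = 0} \<noteq> UNIV" using card_UNIV by auto
  then obtain x where x: "Tr x \<noteq> 0" by auto
  have "Tr (inverse (Tr x) * x) = 1"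
    using x by (subst Tr_scale) (auto intro: subfieldD Tr_in)
  thus ?thesis by (rule that)
qed

text \<open>Translation along \<open>z\<close> carries the fibres of \<open>L\<close> bijectively to
  each other. With \<open>S\<close> the whole field it counts a trace fibre, with \<open>S\<close> a
  trace fibre it counts two simultaneous conditions.\<close>

lemma card_fibre:
  fixes L :: "'a \<Rightarrow> 'a"
  assumes "\<And>x. x \<in> S \<Longrightarrow> L x \<in> F" "b \<in> F"
    and "\<And>x c. x \<in> S \<Longrightarrow> c \<in> F \<Longrightarrow> x + c * z \<in> S \<and> L (x + c * z) = L x + c"
  shows "q * card {x\<in>S. L x = b} = card S"
proof -
  have "card {x\<in>S. L x = c} = card {x\<in>S. L x = b}" if "c \<in> F" for c
  proof (rule bij_betw_same_card)
    have 1: "b - c \<in> F" "c - b \<in> F" using that assms(2) subfieldD by auto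
    show "bij_betw (\<lambda>x. x + (b - c) * z) {x\<in>S. L x = c} {x\<in>S. L x = b}"
    proof (rule bij_betw_byWitness[of _ "\<lambda>x. x + (c - b) * z"])
      show "(\<lambda>x. x + (b - c) * z) ` {x\<in>S. L x = c} \<subseteq> {x\<in>S. L x = b}"
        using assms(3)[OF _ 1(1)] by auto
      show "(\<lambda>x. x + (c - b) * z) ` {x\<in>S. L x = b} \<subseteq> {x\<in>S. L x = c}"
        using assms(3)[OF _ 1(2)] by auto
    qed (simp_all add: algebra_simps)
  qed
  hence "q * card {x\<in>S. L x = b} = (\<Sum>c\<in>F. card {x\<in>S. L x = c})"
    by (simp add: card_F)
  also have "\<dots> = card (\<Union>c\<in>F. {x\<in>S. L x = c})"
    by (subst card_UN_disjoint) auto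
  also have "(\<Union>c\<in>F. {x\<in>S. L x = c}) = S" using assms(1) by auto
  finally show ?thesis .
qed

lemma card_Tr_eq:
  assumes "\<beta> \<in> F"
  shows "card {x. Tr x = \<beta>} = q ^ (n - 1)"
proof -
  obtain x0 where "Tr x0 = 1" by (rule Tr_eq_1)
  hence "q * card {x\<in>UNIV. Tr x = \<beta>} = card (UNIV :: 'a set)"
    using assms by (intro card_fibre[where z = x0]) (auto simp: Tr_in Tr_add Tr_scale)
  also have "\<dots> = q * q ^ (n - 1)"
    using n_ge_2 by (simp add: card_UNIV flip: power_Suc)
  finally show ?thesis using q_ge_2 by simp
qed

text \<open>If \<open>Tr (t * z)\<close> vanished whenever \<open>Tr z\<close> does, it would be
  \<open>c * Tr z\<close> for a \<open>c\<close> in \<open>F\<close>, so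
  \<open>Tr ((t - c) * x)\<close> would be identically zero although \<open>t \<noteq> c\<close>.
  Hence some \<open>z\<close> of trace zero has \<open>Tr (t * z) = 1\<close>, and translating along
  it splits the trace fibre evenly.\<close>

lemma card_Tr_eq_Tr_mult_eq:
  assumes "\<beta> \<in> F" "t \<notin> F"
  shows "card {x. Tr x = \<beta> \<and> Tr (t * x) = \<beta>} = q ^ (n - 2)"
proof -
  obtain x0 where x0: "Tr x0 = 1" by (rule Tr_eq_1)
  have "\<exists>z. Tr z = 0 \<and> Tr (t * z) \<noteq> 0"
  proof (rule ccontr)
    assume "\<not> ?thesis"
    hence *: "Tr z = 0 \<Longrightarrow> Tr (t * z) = 0" for z by blast
    define c where "c = Tr (t * x0)"
    have c: "c \<in> F" by (simp add: c_def Tr_in)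
    have tc: "t - c \<noteq> 0" using assms(2) c by auto
    have "Tr ((t - c) * x) = 0" for x
    proof -
      have "Tr (x - Tr x * x0) = 0" by (simp add: Tr_diff Tr_scale Tr_in x0)
      hence "Tr (t * (x - Tr x * x0)) = 0" by (rule *)
      moreover have "t * (x - Tr x * x0) = t * x - Tr x * (t * x0)" by (simp add: algebra_simps)
      ultimately have "Tr (t * x) = Tr x * c" by (simp add: Tr_diff Tr_scale Tr_in c_def)
      thus ?thesis by (simp add: left_diff_distrib Tr_diff Tr_scale c)
    qed
    from this[of "x0 / (t - c)"] tc x0 show False by simp
  qed
  then obtain z' where z': "Tr z' = 0" "Tr (t * z') \<noteq> 0" by blast
  define z where "z = inverse (Tr (t * z')) * z'"
  have z: "Tr z = 0" "Tr (t * z) = 1"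
    using z' Tr_scale[of "inverse (Tr (t * z'))"] subfieldD(5)[OF Tr_in, of "t * z'"]
    by (auto simp: z_def mult.left_commute[of t])
  have "q * card {x\<in>{x. Tr x = \<beta>}. Tr (t * x) = \<beta>} = card {x. Tr x = \<beta>}"
    using assms z
    by (intro card_fibre[where z = z])
       (auto simp: Tr_in Tr_add Tr_scale distrib_left mult.left_commute[of t])
  also have "\<dots> = q ^ Suc (n - 2)"
    using n_ge_2 card_Tr_eq[OF assms(1)] by (simp add: Suc_diff_Suc numeral_2_eq_2)
  finally show ?thesis using q_ge_2 by simp
qed

end

section \<open>Discrete logarithms and characters with respect to a generator\<close>

locale finite_field_with_generator = subfield_of_finite_field F q n
  for F :: "'a::{field,finite} set" and q n +
  fixes g :: 'a
  assumes bij_g: "bij_betw (\<lambda>i. g ^ i) {..<q ^ n - 1} (UNIV - {0})"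
    and g_power_N: "g ^ (q ^ n - 1) = 1" and g_nz: "g \<noteq> 0"
begin

definition N :: nat where "N = q ^ n - 1"

text \<open>The index of the multiplicative group of \<open>F\<close> in that of the whole
  field.\<close>

definition Q :: nat where "Q = N div (q - 1)"

definition E :: "'a \<Rightarrow> nat set" where "E \<beta> = {i. i < N \<and> Tr (g ^ i) = \<beta>}"

text \<open>\<open>the_inv_into\<close> is the discrete logarithm to base \<open>g\<close>. It has
  no meaning at \<open>0\<close>, so the character sums range over nonzero elements.\<close>

definition \<chi> :: "nat \<Rightarrow> 'a \<Rightarrow> complex" where
  "\<chi> k x = unit_char N k (the_inv_into {..<N} (\<lambda>i. g ^ i) x)"

lemma N_pos: "N > 0"
proof -
  have "q ^ 1 \<le> q ^ n" using q_ge_2 n_ge_2 by (intro power_increasing) auto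
  thus ?thesis using q_ge_2 by (simp add: N_def)
qed

lemma N_eq: "N = (q - 1) * Q"
proof -
  have "[q = 1] (mod (q - 1))"
    using q_ge_2 by (simp add: cong_altdef_nat)
  hence "[q ^ n = 1 ^ n] (mod (q - 1))" by (rule cong_pow)
  hence "q - 1 dvd N" using q_ge_2 by (simp add: cong_altdef_nat N_def)
  thus ?thesis by (simp add: Q_def)
qed

lemma g_power_mod: "g ^ (i mod N) = g ^ i"
proof -
  have "g ^ i = g ^ (N * (i div N) + i mod N)" by simp
  also have "\<dots> = g ^ (i mod N)"
    using g_power_N by (simp only: power_add power_mult N_def) simp
  finally show ?thesis by simp
qed

lemma g_power_eq_1_iff: "g ^ i = 1 \<longleftrightarrow> N dvd i"
proof
  assume "g ^ i = 1"
  hence "g ^ (i mod N) = g ^ 0" by (simp add: g_power_mod)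
  hence "i mod N = 0"
    using bij_g N_pos by (auto simp: bij_betw_def N_def inj_on_def)
  thus "N dvd i" by auto
next
  assume "N dvd i"
  thus "g ^ i = 1" using g_power_N by (auto simp: N_def power_mult)
qed

lemma \<chi>_g_power: "\<chi> k (g ^ i) = unit_char N k i"
proof -
  have "the_inv_into {..<N} (\<lambda>i. g ^ i) (g ^ (i mod N)) = i mod N"
    using bij_g N_pos by (intro the_inv_into_f_f) (auto simp: bij_betw_def N_def)
  thus ?thesis using N_pos by (simp add: \<chi>_def g_power_mod unit_char_mod)
qed

lemma nonzero_eq_g_power:
  assumes "x \<noteq> 0"
  obtains i where "i < N" "x = g ^ i"
proof -
  have "x \<in> (\<lambda>i. g ^ i) ` {..<N}"
    using bij_g assms by (auto simp: bij_betw_def N_def)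
  thus ?thesis using that by blast
qed

lemma \<chi>_mult: "x \<noteq> 0 \<Longrightarrow> y \<noteq> 0 \<Longrightarrow> \<chi> k (x * y) = \<chi> k x * \<chi> k y"
  by (metis nonzero_eq_g_power \<chi>_g_power power_add unit_char_add_right)

lemma norm_\<chi>: "norm (\<chi> k x) = 1"
  by (simp add: \<chi>_def)

lemma \<chi>_1: "\<chi> k 1 = 1"
  using \<chi>_g_power[of k 0] by (simp add: unit_char_def)

lemma sum_\<chi>: assumes "\<not> N dvd k" shows "(\<Sum>x\<in>UNIV - {0}. \<chi> k x) = 0"
proof -
  have "(\<Sum>x\<in>UNIV - {0}. \<chi> k x) = (\<Sum>i<N. \<chi> k (g ^ i))"
    using bij_g by (intro sum.reindex_bij_betw [symmetric]) (simp add: N_def)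
  \<comment> \<open>\<open>unit_char\<close> is symmetric in its last two arguments, so
    orthogonality in the index applies.\<close>
  also have "\<dots> = (\<Sum>i<N. unit_char N i k)"
    by (simp add: \<chi>_g_power) (simp add: unit_char_def mult.commute)
  finally show ?thesis using assms N_pos by (simp add: sum_unit_char_left)
qed

lemma sum_E: assumes "D = {x. x \<noteq> 0 \<and> Tr x = \<beta>}"
  shows "(\<Sum>i\<in>E \<beta>. unit_char N k i) = (\<Sum>x\<in>D. \<chi> k x)" "card (E \<beta>) = card D"
proof -
  have "bij_betw (\<lambda>i. g ^ i) (E \<beta>) D"
    using bij_g g_nz by (auto simp: bij_betw_def E_def N_def assms inj_on_def)
  thus "(\<Sum>i\<in>E \<beta>. unit_char N k i) = (\<Sum>x\<in>D. \<chi> k x)" "card (E \<beta>) = card D"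
    by (auto simp: \<chi>_g_power bij_betw_same_card simp flip: sum.reindex_bij_betw)
qed

lemma finite_E: "finite (E \<beta>)"
  by (simp add: E_def)

section \<open>Fourier coefficients of the trace fibres\<close>

lemma sum_\<chi>_subfield:
  "(\<Sum>t\<in>F - {0}. \<chi> k t) = 0 \<or> (\<Sum>t\<in>F - {0}. \<chi> k t) = of_nat (q - 1)"
proof (cases "\<forall>c\<in>F - {0}. \<chi> k c = 1")
  case True
  hence "(\<Sum>t\<in>F - {0}. \<chi> k t) = of_nat (card (F - {0}))" by simp
  also have "card (F - {0}) = q - 1"
    using card_F subfieldD(1) by (simp add: card_Diff_subset)
  finally show ?thesis by blast
next
  case False
  then obtain c where c: "c \<in> F" "c \<noteq> 0" "\<chi> k c \<noteq> 1" by blast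
  have "(\<Sum>t\<in>F - {0}. \<chi> k t) = (\<Sum>t\<in>F - {0}. \<chi> k (c * t))"
    by (rule sum.reindex_bij_witness[of _ "\<lambda>t. c * t" "\<lambda>t. t / c"])
       (use c in \<open>auto intro: subfieldD subfield_divide\<close>)
  also have "\<dots> = \<chi> k c * (\<Sum>t\<in>F - {0}. \<chi> k t)"
    unfolding sum_distrib_left using c by (intro sum.cong refl) (simp add: \<chi>_mult)
  finally show ?thesis using c(3) by simp
qed

lemma sum_\<chi>_not_subfield:
  assumes "\<not> N dvd k"
  shows "(\<Sum>t\<in>- F. \<chi> k t) = - (\<Sum>t\<in>F - {0}. \<chi> k t)"
proof -
  have "(\<Sum>x\<in>UNIV - {0}. \<chi> k x) = (\<Sum>t\<in>F - {0}. \<chi> k t) + (\<Sum>t\<in>- F. \<chi> k t)"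
    using subfieldD(1) by (subst sum.union_disjoint [symmetric]) (auto intro!: sum.cong)
  thus ?thesis using sum_\<chi>[OF assms] by (simp add: eq_neg_iff_add_eq_0 add.commute)
qed

text \<open>The character sums to zero over all nonzero \<open>t\<close>, so the constant
  \<open>c\<close> can be subtracted from every autocorrelation. Only \<open>t\<close> in
  \<open>F\<close> then contributes.\<close>

lemma norm_sum_squared_split:
  assumes "\<not> N dvd k" "\<beta> \<in> F" "D = {x. x \<noteq> 0 \<and> Tr x = \<beta>}"
    and "\<And>t. t \<notin> F \<Longrightarrow> card {y\<in>D. t * y \<in> D} = c"
  shows "of_real ((norm (\<Sum>i\<in>E \<beta>. unit_char N k i))\<^sup>2)
    = (\<Sum>t\<in>F - {0}. (of_nat (card {y\<in>D. t * y \<in> D}) - of_nat c) * \<chi> k t)"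
proof -
  let ?r = "\<lambda>t. of_nat (card {y\<in>D. t * y \<in> D}) * \<chi> k t"
  have "of_real ((norm (\<Sum>i\<in>E \<beta>. unit_char N k i))\<^sup>2) = (\<Sum>t\<in>UNIV - {0}. ?r t)"
    unfolding sum_E(1)[OF assms(3)]
    by (rule norm_sum_multiplicative_squared) (auto simp: \<chi>_mult norm_\<chi> assms(3))
  also have "\<dots> = (\<Sum>t\<in>F - {0}. ?r t) + (\<Sum>t\<in>- F. ?r t)"
    using subfieldD(1) by (subst sum.union_disjoint [symmetric]) (auto intro!: sum.cong)
  also have "(\<Sum>t\<in>- F. ?r t) = of_nat c * (\<Sum>t\<in>- F. \<chi> k t)"
    using assms(4) by (simp add: sum_distrib_left)
  also have "\<dots> = - (\<Sum>t\<in>F - {0}. of_nat c * \<chi> k t)"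
    by (simp add: sum_\<chi>_not_subfield[OF assms(1)] sum_distrib_left)
  finally show ?thesis by (simp add: left_diff_distrib sum_subtractf)
qed

text \<open>For \<open>t\<close> in \<open>F\<close>, scaling by \<open>t\<close> moves the fibre
  off itself unless \<open>t = 1\<close>. The squared norm is therefore \<open>q ^ (n - 1)\<close>
  or \<open>q ^ (n - 2)\<close>, according to whether the character is nontrivial or trivial on
  \<open>F - {0}\<close>.\<close>

lemma nonzero_trace:
  assumes "\<beta> \<in> F" "\<beta> \<noteq> 0"
  shows "card (E \<beta>) = q ^ (n - 1)"
    and "\<not> N dvd k \<Longrightarrow> norm (\<Sum>i\<in>E \<beta>. unit_char N k i) \<le> sqrt (q ^ (n - 1))"
proof -
  define D where "D = {x. x \<noteq> 0 \<and> Tr x = \<beta>}"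
  have D': "D = {x. Tr x = \<beta>}" using assms by (auto simp: D_def)
  show "card (E \<beta>) = q ^ (n - 1)"
    using sum_E(2)[OF D_def] card_Tr_eq[OF assms(1)] by (simp add: D')
  assume k: "\<not> N dvd k"
  have eq: "of_real ((norm (\<Sum>i\<in>E \<beta>. unit_char N k i))\<^sup>2)
    = (\<Sum>t\<in>F - {0}. (of_nat (card {y\<in>D. t * y \<in> D}) - of_nat (q ^ (n - 2))) * \<chi> k t)"
  proof (rule norm_sum_squared_split[OF k assms(1) D_def])
    show "card {y\<in>D. t * y \<in> D} = q ^ (n - 2)" if "t \<notin> F" for t
      using card_Tr_eq_Tr_mult_eq[OF assms(1) that] by (simp add: D')
  qed
  have inF: "card {y\<in>D. t * y \<in> D} = (if t = 1 then q ^ (n - 1) else 0)" if "t \<in> F" for t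
  proof (cases "t = 1")
    case True
    thus ?thesis using card_Tr_eq[OF assms(1)] by (simp add: D')
  next
    case False
    hence "{y\<in>D. t * y \<in> D} = {}" using assms that by (auto simp: D' Tr_scale)
    thus ?thesis using False by simp
  qed
  have "(\<Sum>t\<in>F - {0}. (of_nat (card {y\<in>D. t * y \<in> D}) - of_nat (q ^ (n - 2))) * \<chi> k t)
      = (\<Sum>t\<in>F - {0}. if t = 1 then of_nat (q ^ (n - 1)) else 0)
        - of_nat (q ^ (n - 2)) * (\<Sum>t\<in>F - {0}. \<chi> k t)"
    unfolding sum_distrib_left sum_subtractf [symmetric]
    by (intro sum.cong refl) (auto simp: inF \<chi>_1 algebra_simps)
  also have "(\<Sum>t\<in>F - {0}. if t = 1 then of_nat (q ^ (n - 1)) else 0) = (of_nat (q ^ (n - 1)) :: complex)"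
    using subfieldD(2) by simp
  finally have "of_real ((norm (\<Sum>i\<in>E \<beta>. unit_char N k i))\<^sup>2)
      = of_nat (q ^ (n - 1)) - of_nat (q ^ (n - 2)) * (\<Sum>t\<in>F - {0}. \<chi> k t)"
    unfolding eq .
  hence "complex_of_real ((norm (\<Sum>i\<in>E \<beta>. unit_char N k i))\<^sup>2)
       = of_real (real (q ^ (n - 1))) \<or>
     complex_of_real ((norm (\<Sum>i\<in>E \<beta>. unit_char N k i))\<^sup>2)
       = of_real (real (q ^ (n - 1)) - real (q ^ (n - 2)) * real (q - 1))"
    using sum_\<chi>_subfield[of k] by auto
  hence "(norm (\<Sum>i\<in>E \<beta>. unit_char N k i))\<^sup>2 = real (q ^ (n - 1)) \<or>
     (norm (\<Sum>i\<in>E \<beta>. unit_char N k i))\<^sup>2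
       = real (q ^ (n - 1)) - real (q ^ (n - 2)) * real (q - 1)"
    unfolding of_real_eq_iff .
  moreover have "real (q ^ (n - 2)) * real (q - 1) \<ge> 0" by simp
  ultimately have "(norm (\<Sum>i\<in>E \<beta>. unit_char N k i))\<^sup>2 \<le> real (q ^ (n - 1))" by linarith
  thus "norm (\<Sum>i\<in>E \<beta>. unit_char N k i) \<le> sqrt (q ^ (n - 1))"
    by (intro real_le_rsqrt) simp
qed

text \<open>Here the fibre is stable under \<open>F - {0}\<close>. The squared norm is
  \<open>0\<close> or \<open>(q - 1)\<^sup>2 * q ^ (n - 2)\<close>; the corrections for removing
  \<open>0\<close> cancel.\<close>

lemma zero_trace:
  shows "card (E 0) = q ^ (n - 1) - 1"
    and "\<not> N dvd k \<Longrightarrow> norm (\<Sum>i\<in>E 0. unit_char N k i) \<le> (real q - 1) * sqrt (q ^ (n - 2))"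
proof -
  define D where "D = {x. x \<noteq> 0 \<and> Tr x = 0}"
  have D': "D = {x. Tr x = 0} - {0}" by (auto simp: D_def)
  have cD: "card D = q ^ (n - 1) - 1"
    using card_Tr_eq[OF subfieldD(1)] by (simp add: D' card_Diff_subset)
  thus "card (E 0) = q ^ (n - 1) - 1"
    using sum_E(2)[OF D_def] by simp
  assume k: "\<not> N dvd k"
  have eq: "of_real ((norm (\<Sum>i\<in>E 0. unit_char N k i))\<^sup>2)
    = (\<Sum>t\<in>F - {0}. (of_nat (card {y\<in>D. t * y \<in> D}) - of_nat (q ^ (n - 2) - 1)) * \<chi> k t)"
  proof (rule norm_sum_squared_split[OF k subfieldD(1) D_def])
    fix t assume t: "t \<notin> F"
    hence "{y\<in>D. t * y \<in> D} = {x. Tr x = 0 \<and> Tr (t * x) = 0} - {0}"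
      using subfieldD(1) by (auto simp: D_def)
    thus "card {y\<in>D. t * y \<in> D} = q ^ (n - 2) - 1"
      using card_Tr_eq_Tr_mult_eq[OF subfieldD(1) t] by (simp add: card_Diff_subset)
  qed
  have "card {y\<in>D. t * y \<in> D} = q ^ (n - 1) - 1" if "t \<in> F - {0}" for t
  proof -
    have "{y\<in>D. t * y \<in> D} = D" using that by (auto simp: D_def Tr_scale)
    thus ?thesis by (simp add: cD)
  qed
  hence "(\<Sum>t\<in>F - {0}. (of_nat (card {y\<in>D. t * y \<in> D}) - of_nat (q ^ (n - 2) - 1)) * \<chi> k t)
      = (of_nat (q ^ (n - 1) - 1) - of_nat (q ^ (n - 2) - 1)) * (\<Sum>t\<in>F - {0}. \<chi> k t)"
    unfolding sum_distrib_left by (intro sum.cong refl) simp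
  also have "(of_nat (q ^ (n - 1) - 1) - of_nat (q ^ (n - 2) - 1) :: complex)
      = of_real ((real q - 1) * real (q ^ (n - 2)))"
  proof -
    have "n - 1 = Suc (n - 2)" using n_ge_2 by simp
    thus ?thesis using q_ge_2 by (simp add: of_nat_diff algebra_simps)
  qed
  finally have "of_real ((norm (\<Sum>i\<in>E 0. unit_char N k i))\<^sup>2)
      = of_real ((real q - 1) * real (q ^ (n - 2))) * (\<Sum>t\<in>F - {0}. \<chi> k t)"
    unfolding eq .
  hence "complex_of_real ((norm (\<Sum>i\<in>E 0. unit_char N k i))\<^sup>2) = of_real 0 \<or>
     complex_of_real ((norm (\<Sum>i\<in>E 0. unit_char N k i))\<^sup>2)
       = of_real ((real q - 1) * real (q ^ (n - 2)) * (real q - 1))"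
    using sum_\<chi>_subfield[of k] q_ge_2 by (auto simp: of_nat_diff)
  hence "(norm (\<Sum>i\<in>E 0. unit_char N k i))\<^sup>2 = 0 \<or>
     (norm (\<Sum>i\<in>E 0. unit_char N k i))\<^sup>2 = (real q - 1) * real (q ^ (n - 2)) * (real q - 1)"
    unfolding of_real_eq_iff .
  moreover have "(real q - 1) * real (q ^ (n - 2)) * (real q - 1) \<ge> 0"
    using q_ge_2 by (intro mult_nonneg_nonneg) auto
  ultimately have "(norm (\<Sum>i\<in>E 0. unit_char N k i))\<^sup>2
      \<le> (real q - 1) * real (q ^ (n - 2)) * (real q - 1)" by linarith
  also have "\<dots> = ((real q - 1) * sqrt (q ^ (n - 2)))\<^sup>2"
    by (simp add: power_mult_distrib) (simp add: power2_eq_square)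
  finally show "norm (\<Sum>i\<in>E 0. unit_char N k i) \<le> (real q - 1) * sqrt (q ^ (n - 2))"
    by (rule power2_le_imp_le) (use q_ge_2 in simp)
qed

section \<open>Exponents modulo \<open>Q\<close> and orders of negatives\<close>

lemma g_power_Q_mult_in: "g ^ (Q * t) \<in> F"
proof -
  have "(g ^ (Q * t)) ^ q = g ^ (Q * t) * (g ^ (Q * t)) ^ (q - 1)"
    using q_ge_2 by (simp flip: power_Suc)
  also have "(g ^ (Q * t)) ^ (q - 1) = (g ^ N) ^ t"
    by (simp add: N_eq mult_ac flip: power_mult)
  also have "\<dots> = 1" using g_power_N by (simp add: N_def)
  finally show ?thesis by (simp add: subfield_iff)
qed

text \<open>Distinct elements of equal nonzero trace are not proportional over the subfield, so reduction
  modulo \<open>Q\<close> is injective on \<open>E \<beta>\<close>.\<close>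

lemma card_E_dvd_le:
  assumes "\<beta> \<noteq> 0" "r dvd Q"
  shows "r * card {i\<in>E \<beta>. r dvd i} \<le> Q"
proof -
  have Q0: "Q > 0" using N_pos N_eq by (auto intro: Nat.gr0I)
  hence r0: "r > 0" using assms(2) by (auto intro: Nat.gr0I)
  have *: "i = j" if ij: "i \<in> E \<beta>" "j \<in> E \<beta>" "i mod Q = j mod Q" "i \<le> j" for i j
  proof -
    obtain t where t: "j = i + Q * t"
      using ij(3,4) by (metis le_add_diff_inverse mod_eq_dvd_iff_nat dvdE)
    have "\<beta> = g ^ (Q * t) * \<beta>"
      using ij(1,2) Tr_scale[OF g_power_Q_mult_in[of t], of "g ^ i"]
      by (simp add: E_def t power_add mult.commute)
    hence "g ^ (Q * t) = 1" using assms(1) by simp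
    hence "g ^ i = g ^ j" by (simp add: t power_add)
    thus ?thesis
      using ij(1,2) bij_g by (auto simp: E_def bij_betw_def inj_on_def N_def)
  qed
  have inj: "inj_on (\<lambda>i. i mod Q) {i\<in>E \<beta>. r dvd i}"
  proof (rule inj_onI)
    fix i j assume "i \<in> {i\<in>E \<beta>. r dvd i}" "j \<in> {i\<in>E \<beta>. r dvd i}" "i mod Q = j mod Q"
    thus "i = j" using *[of i j] *[of j i] by (cases "i \<le> j") auto
  qed
  \<comment> \<open>As \<open>r\<close> divides \<open>Q\<close>, reduction keeps multiples of
    \<open>r\<close>, and there are only \<open>Q div r\<close> of them below
    \<open>Q\<close>.\<close>
  have "(\<lambda>i. i mod Q) ` {i\<in>E \<beta>. r dvd i} \<subseteq> (\<lambda>m. r * m) ` {..<Q div r}"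
  proof safe
    fix i assume "r dvd i"
    hence "r dvd i mod Q" using assms(2) by (simp add: dvd_mod)
    then obtain m where m: "i mod Q = r * m" by blast
    have "r * m < Q" using m Q0 mod_less_divisor[of Q i] by simp
    also have "Q = r * (Q div r)" using assms(2) by simp
    finally have "m < Q div r" using r0 by simp
    thus "i mod Q \<in> (\<lambda>m. r * m) ` {..<Q div r}" using m by auto
  qed
  hence "card {i\<in>E \<beta>. r dvd i} \<le> card ((\<lambda>m. r * m) ` {..<Q div r})"
    unfolding card_image[OF inj, symmetric] by (intro card_mono) auto
  also have "\<dots> \<le> Q div r" by (rule order.trans[OF card_image_le]) auto
  finally have "r * card {i\<in>E \<beta>. r dvd i} \<le> r * (Q div r)" by simp
  thus ?thesis using assms(2) by simp
qed

text \<open>Shifting the exponent by \<open>Q * t\<close> multiplies by an element of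
  \<open>F\<close>, which keeps trace zero; a suitable \<open>t\<close> also avoids the remaining
  primes of \<open>N\<close>.\<close>

lemma zero_trace_lift:
  assumes "{i\<in>E 0. \<forall>p\<in>prime_factors Q. \<not> p dvd i} \<noteq> {}"
  obtains i where "coprime i N" "Tr (g ^ i) = 0"
proof -
  have Q0: "Q > 0" using N_pos N_eq by (auto intro: Nat.gr0I)
  obtain i where i: "i \<in> E 0" "coprime i Q"
    using assms by (auto simp: coprime_iff_prime_factors[OF Q0])
  then obtain t where t: "coprime (i + Q * t) N"
    using exists_coprime_add_mult N_pos by blast
  have "Tr (g ^ (i + Q * t)) = g ^ (Q * t) * Tr (g ^ i)"
    using Tr_scale[OF g_power_Q_mult_in[of t], of "g ^ i"] by (simp add: power_add mult.commute)
  thus ?thesis using i t that by (simp add: E_def)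
qed

text \<open>Write \<open>N = 2 * m\<close> with \<open>m\<close> odd and \<open>x = g ^ i\<close>.
  Then \<open>x ^ m = - 1\<close>, so \<open>(- x) ^ m = 1\<close>; conversely
  \<open>(- x) ^ k = 1\<close> gives \<open>x ^ (2 * k) = 1\<close>, so \<open>m\<close> divides
  \<open>k\<close>.\<close>

lemma two_primitive_uminus:
  assumes "odd (N div 2)" "even N" "coprime i N"
  shows "two_primitive q n (- (g ^ i))"
proof -
  define m where "m = N div 2"
  have N: "N = 2 * m" using assms(2) by (simp add: m_def)
  have m: "odd m" "m > 0" using assms(1) by (auto simp: m_def intro: Nat.gr0I)
  have pow: "(g ^ i) ^ k = 1 \<longleftrightarrow> N dvd k" for k
  proof -
    have "(g ^ i) ^ k = 1 \<longleftrightarrow> N dvd i * k" by (simp add: g_power_eq_1_iff flip: power_mult)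
    thus ?thesis using assms(3) by (simp add: coprime_dvd_mult_right_iff coprime_commute)
  qed
  have "((g ^ i) ^ m) ^ 2 = 1" using pow[of "m * 2"] N by (simp add: power_mult)
  moreover have "(g ^ i) ^ m \<noteq> 1" using pow[of m] N m by (auto dest: dvd_imp_le)
  ultimately have "(g ^ i) ^ m = - 1" by (metis power2_eq_1_iff)
  hence one: "(- (g ^ i)) ^ m = 1" using m by (simp add: power_minus_odd)
  have least: "m \<le> k" if "k > 0" "(- (g ^ i)) ^ k = 1" for k
  proof -
    have "(g ^ i) ^ (2 * k) = ((- (g ^ i)) ^ k) ^ 2" by (simp add: mult.commute flip: power_mult)
    hence "N dvd 2 * k" using pow that by simp
    thus ?thesis using N that by (auto dest: dvd_imp_le)
  qed
  have "\<exists>k>0. (- (g ^ i)) ^ k = 1" using one m(2) by blast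
  hence "mult_order (- (g ^ i)) = (LEAST k. k > 0 \<and> (- (g ^ i)) ^ k = 1)"
    unfolding mult_order_def by (rule if_P)
  also have "\<dots> = m"
    using one least m by (intro Least_equality) auto
  finally show ?thesis by (simp add: two_primitive_def m_def N_def)
qed

end

section \<open>Primitive elements with prescribed trace\<close>

context finite_field_with_generator
begin

text \<open>The main term is \<open>B * B\<close>, so the Moebius criterion follows from
  \<open>2 ^ s \<le> B\<close>.\<close>

lemma exists_primitive_nonzero_trace_moebius:
  assumes "\<beta> \<in> F" "\<beta> \<noteq> 0" "4 ^ card (prime_factors N) \<le> q ^ (n - 1)"
  shows "\<exists>i. coprime i N \<and> Tr (g ^ i) = \<beta>"
proof -
  define B where "B = sqrt (q ^ (n - 1))"
  define s where "s = card (prime_factors N)"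
  have B2: "B * B = real (q ^ (n - 1))" by (simp add: B_def)
  have "(2 ^ s)\<^sup>2 = real (4 ^ s)"
    using power_mult[of "2::real" 2 s] power_mult[of "2::real" s 2] by (simp add: mult.commute)
  also have "\<dots> \<le> real (q ^ (n - 1))" using assms(3) unfolding s_def of_nat_le_iff .
  finally have "2 ^ s \<le> B" unfolding B_def by (intro real_le_rsqrt) simp
  moreover have "B > 0" unfolding B_def using q_ge_2 by simp
  ultimately have "(2 ^ s - 1) * B < B * B" by (intro mult_strict_right_mono) auto
  hence "{i\<in>E \<beta>. \<forall>p\<in>prime_factors N. \<not> p dvd i} \<noteq> {}"
    using nonzero_trace[OF assms(1,2)] N_pos
    by (intro sifted_nonempty_moebius[where B = B and N = N])
       (auto simp: finite_E B2 s_def B_def in_prime_factors_iff)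
  thus ?thesis using N_pos by (auto simp: coprime_iff_prime_factors E_def)
qed

text \<open>For the \<open>q\<close> where sieving by all primes of \<open>N\<close> is too lossy,
  only \<open>P\<close> is sieved. The multiples of the last prime \<open>r\<close> are bounded by
  \<open>Q / r\<close> through \<open>card_E_dvd_le\<close>; if more exponents survive than that,
  one of them avoids \<open>r\<close>.\<close>

lemma exists_primitive_nonzero_trace_small:
  assumes "\<beta> \<in> F" "\<beta> \<noteq> 0" "finite P" "\<And>p. p \<in> P \<Longrightarrow> prime p \<and> p dvd N"
    and "prime_factors N \<subseteq> insert r P" "r dvd Q"
    and "real Q < real r * ((\<Prod>p\<in>P. 1 - 1 / real p)
           * (real (q ^ (n - 1)) - (2 ^ card P - 1) * sqrt (q ^ (n - 1))))"
  shows "\<exists>i. coprime i N \<and> Tr (g ^ i) = \<beta>"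
proof -
  let ?S = "{i\<in>E \<beta>. \<forall>p\<in>P. \<not> p dvd i}" and ?R = "{i\<in>E \<beta>. r dvd i}"
  have "real (r * card ?R) \<le> real Q"
    using card_E_dvd_le[OF assms(2,6)] by (simp only: of_nat_le_iff)
  also note assms(7)
  also have "real r * ((\<Prod>p\<in>P. 1 - 1 / real p)
           * (real (q ^ (n - 1)) - (2 ^ card P - 1) * sqrt (q ^ (n - 1)))) \<le> real r * real (card ?S)"
    using card_sifted_ge[OF assms(3) N_pos finite_E[of \<beta>] nonzero_trace(2)[OF assms(1,2)] assms(4)]
    by (intro mult_left_mono) (simp_all add: nonzero_trace(1)[OF assms(1,2)])
  finally have "card ?R < card ?S" by (simp add: mult_less_cancel_left)
  hence "\<not> ?S \<subseteq> ?R" using card_mono[of ?R ?S] by (auto simp: finite_E not_less)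
  then obtain i where "i \<in> E \<beta>" "\<forall>p\<in>P. \<not> p dvd i" "\<not> r dvd i" by blast
  thus ?thesis using N_pos assms(5) by (auto simp: coprime_iff_prime_factors E_def)
qed

lemma Q_cubic:
  assumes "n = 3"
  shows "Q = q ^ 2 + q + 1"
proof -
  obtain m where m: "q = Suc m" using q_ge_2 by (cases q) auto
  have "(q - 1) * (q ^ 2 + q + 1) = q ^ 3 - 1"
    by (simp add: m power2_eq_square power3_eq_cube algebra_simps)
  also have "\<dots> = (q - 1) * Q"
    using N_eq assms by (metis N_def)
  finally have "q - 1 = 0 \<or> Q = q ^ 2 + q + 1" unfolding mult_cancel1 by auto
  thus ?thesis using q_ge_2 by simp
qed

lemma exists_primitive_nonzero_trace:
  assumes "q mod 4 = 3" "odd n" "\<beta> \<in> F" "\<beta> \<noteq> 0"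
  shows "\<exists>i. coprime i N \<and> Tr (g ^ i) = \<beta>"
proof (cases "n = 3")
  case False
  hence "n \<ge> 5" using assms(2) n_ge_2 by presburger
  thus ?thesis
    using omega_power_minus_1[OF assms(1,2)] assms(3,4)
    by (intro exists_primitive_nonzero_trace_moebius) (auto simp: N_def)
next
  case n: True
  note Q = Q_cubic[OF n]
  have N: "N = (q - 1) * (q ^ 2 + q + 1)" using N_eq Q by simp
  have pf: "prime_factors N \<subseteq> set ps" if "N = prod_list ps" "\<forall>p\<in>set ps. prime p" for ps
    unfolding that(1) using prime_factors_prod_list[OF that(2)] by simp
  \<comment> \<open>For \<open>3\<close>, \<open>7\<close>, \<open>11\<close> the inequality
    \<open>2 ^ \<omega> \<le> q\<close> fails; in each case \<open>r\<close> is the largest prime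
    factor of \<open>N\<close>.\<close>
  consider "q = 3" | "q = 7" | "q = 11" | "q \<noteq> 3" "q \<noteq> 7" "q \<noteq> 11" by blast
  thus ?thesis
  proof cases
    case 1
    show ?thesis
      by (rule exists_primitive_nonzero_trace_small[where P = "{2}" and r = 13])
         (use assms 1 n N Q pf[of "[2, 13]"] in auto)
  next
    case 2
    show ?thesis
      by (rule exists_primitive_nonzero_trace_small[where P = "{2, 3}" and r = 19])
         (use assms 2 n N Q pf[of "[2, 3, 3, 19]"] in auto)
  next
    case 3
    show ?thesis
      by (rule exists_primitive_nonzero_trace_small[where P = "{2, 5, 7}" and r = 19])
         (use assms 3 n N Q pf[of "[2, 5, 7, 19]"] in auto)
  next
    case 4
    have "2 ^ card (prime_factors N) \<le> q"
      using omega_cube_minus_1[OF assms(1) 4] n by (metis N_def)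
    hence "(2 ^ card (prime_factors N)) ^ 2 \<le> q ^ 2" by (intro power_mono) auto
    moreover have "(2 ^ s) ^ 2 = (4 ^ s :: nat)" for s
      using power_mult[of "2::nat" 2 s] power_mult[of "2::nat" s 2] by (simp add: mult.commute)
    ultimately have "4 ^ card (prime_factors N) \<le> q ^ 2" by simp
    moreover have "n - 1 = 2" using n by simp
    ultimately have "4 ^ card (prime_factors N) \<le> q ^ (n - 1)" by simp
    thus ?thesis using assms(3,4) by (intro exists_primitive_nonzero_trace_moebius)
  qed
qed

text \<open>With \<open>w\<close> the square root of \<open>q ^ (n - 2)\<close>, the fibre has
  \<open>q * w * w - 1\<close> elements and the error is \<open>(q - 1) * w\<close>. For
  \<open>n \<ge> 5\<close> the estimate \<open>2 ^ s \<le> w\<close> suffices.\<close>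

lemma exists_primitive_zero_trace:
  assumes "q mod 4 = 3" "odd n" "odd Q"
  shows "\<exists>i. coprime i N \<and> Tr (g ^ i) = 0"
proof -
  define P where "P = prime_factors Q"
  define w where "w = sqrt (q ^ (n - 2))"
  define B where "B = (real q - 1) * w"
  have w2: "w * w = real (q ^ (n - 2))" by (simp add: w_def)
  have w1: "w \<ge> 1" using q_ge_2 by (simp add: w_def)
  have cE: "real (card (E 0)) = real q * (w * w) - 1"
  proof -
    have "q ^ (n - 1) \<ge> 1" "n - 1 = Suc (n - 2)" using q_ge_2 n_ge_2 by auto
    thus ?thesis unfolding zero_trace(1) w2 by (simp add: of_nat_diff)
  qed
  have P: "finite P" "\<And>p. p \<in> P \<Longrightarrow> prime p \<and> p dvd N"
    by (auto simp: P_def N_eq in_prime_factors_iff)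
  note sieve = P(1) N_pos finite_E[of 0] zero_trace(2)[folded w_def, folded B_def] P(2)
  have "{i\<in>E 0. \<forall>p\<in>P. \<not> p dvd i} \<noteq> {}"
  proof (cases "n = 3")
    case False
    hence n: "n \<ge> 5" using assms(2) n_ge_2 by presburger
    define s where "s = card P"
    have "(2 ^ s)\<^sup>2 = real (4 ^ s)"
      using power_mult[of "2::real" 2 s] power_mult[of "2::real" s 2] by (simp add: mult.commute)
    also have "\<dots> \<le> real (q ^ (n - 2))"
      using omega_quotient[OF assms(1,2) n _ assms(3)] N_eq
      unfolding s_def P_def of_nat_le_iff by (simp add: N_def)
    finally have ws: "2 ^ s \<le> w" unfolding w_def by (intro real_le_rsqrt) simp
    have q2: "real q \<ge> 2" using q_ge_2 by simp
    have "(2 ^ s - 1) * B \<le> (w - 1) * B"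
      using ws w1 q2 by (intro mult_right_mono) (auto simp: B_def)
    also have "\<dots> = (real q - 1) * (w * w) - (real q - 1) * w" by (simp add: B_def algebra_simps)
    also have "\<dots> < real q * (w * w) - 1"
    proof -
      have "w * w \<ge> 1" using w1 mult_mono[of 1 w 1 w] by simp
      moreover have "(real q - 1) * w \<ge> 1 * 1" using q2 w1 by (intro mult_mono) auto
      ultimately show ?thesis by (simp add: left_diff_distrib)
    qed
    finally have "(2 ^ card P - 1) * B < real (card (E 0))" by (simp add: cE s_def)
    with sieve show ?thesis by (rule sifted_nonempty_moebius)
  next
    case n: True
    have w: "w = sqrt q" by (simp add: w_def n)
    \<comment> \<open>For \<open>n = 3\<close> the factor \<open>q - 1\<close> is common to main
      term and error; cancelling it leaves the alternatives of
      \<open>omega_quadratic\<close>.\<close>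
    have cE': "real (card (E 0)) = (real q - 1) * (real q + 1)"
      unfolding cE w by (simp add: algebra_simps)
    have q1: "real q - 1 > 0" using q_ge_2 by simp
    define \<sigma> where "\<sigma> = (\<Sum>p\<in>P. 1 / real p)"
    have "(2 ^ card P - 1) * w < real q + 1 \<or>
        (real q + 1) * \<sigma> + (real (card P) - \<sigma>) * w < real q + 1"
      using omega_quadratic[OF assms(1)] unfolding P_def \<sigma>_def Q_cubic[OF n] w .
    thus ?thesis
    proof
      assume "(2 ^ card P - 1) * w < real q + 1"
      from mult_strict_left_mono[OF this q1]
      have "(2 ^ card P - 1) * B < real (card (E 0))" by (simp add: cE' B_def mult_ac)
      with sieve show ?thesis by (rule sifted_nonempty_moebius)
    next
      assume "(real q + 1) * \<sigma> + (real (card P) - \<sigma>) * w < real q + 1"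
      from mult_strict_left_mono[OF this q1]
      have "real (card (E 0)) * \<sigma> + (real (card P) - \<sigma>) * B < real (card (E 0))"
        by (simp add: cE' B_def algebra_simps)
      with sieve show ?thesis unfolding \<sigma>_def by (rule sifted_nonempty_union)
    qed
  qed
  thus ?thesis using zero_trace_lift unfolding P_def by blast
qed

end

theorem theorem3p2:
  fixes F :: "'a::{field,finite} set" and q n :: nat
  assumes "primepow q" and "odd q"
    and "n \<ge> 2"
    and "odd ((q ^ n - 1) div 2)"
    and "CARD('a) = q ^ n"
    and "is_subfield F" and "card F = q"
  shows "\<forall>\<beta>\<in>F. \<exists>\<xi>::'a. two_primitive q n \<xi> \<and> field_trace q n \<xi> = \<beta>"
proof
  fix \<beta> assume \<beta>: "\<beta> \<in> F"
  obtain g :: 'a where g: "bij_betw (\<lambda>i. g ^ i) {..<q ^ n - 1} (UNIV - {0})"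
    "g ^ (q ^ n - 1) = 1" "g \<noteq> 0"
    using finite_field_generator[where ?'a = 'a] unfolding assms(5) by blast
  interpret finite_field_with_generator F q n g
    by unfold_locales (use assms g in auto)
  have qn: "q ^ n mod 4 = 3"
  proof -
    have "odd (q ^ n)" using assms(2) by simp
    then obtain m where m: "q ^ n = 2 * m + 1" by (rule oddE)
    hence "odd m" using assms(4) by simp
    then obtain l where "m = 2 * l + 1" by (rule oddE)
    thus ?thesis using m by simp
  qed
  have "q mod 4 = 1 \<or> q mod 4 = 3" using assms(2) by presburger
  moreover have "q mod 4 \<noteq> 1" using qn power_mod[of q 4 n] by auto
  ultimately have q4: "q mod 4 = 3" by blast
  \<comment> \<open>For even \<open>n\<close> the number \<open>q ^ n\<close> would be an odd
    square, hence \<open>1\<close> modulo \<open>4\<close>.\<close>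
  have n: "odd n"
  proof
    assume "even n"
    then obtain k where "n = 2 * k" by blast
    hence "q ^ n mod 4 = (q ^ 2 mod 4) ^ k mod 4" by (simp add: power_mult power_mod)
    also have "q ^ 2 mod 4 = (q mod 4) ^ 2 mod 4" by (rule power_mod [symmetric])
    finally show False using qn q4 by simp
  qed
  have N: "odd (N div 2)" "even N" using assms(2,4) by (simp_all add: N_def)
  have "odd Q"
  proof
    assume "even Q"
    moreover have "even (q - 1)" using assms(2) by simp
    ultimately have "2 * 2 dvd N" unfolding N_eq by (rule mult_dvd_mono[rotated])
    thus False using N by (metis dvd_div_iff_mult dvd_mult_imp_div zero_neq_numeral)
  qed
  \<comment> \<open>The trace sought is \<open>- \<beta>\<close>, since the final element is
    \<open>- (g ^ i)\<close>.\<close>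
  then obtain i where "coprime i N" "Tr (g ^ i) = - \<beta>"
    using exists_primitive_zero_trace[OF q4 n] exists_primitive_nonzero_trace[OF q4 n, of "- \<beta>"]
      subfield_uminus[OF \<beta>] by (cases "\<beta> = 0") auto
  hence "two_primitive q n (- (g ^ i)) \<and> Tr (- (g ^ i)) = \<beta>"
    using two_primitive_uminus[OF N] by (simp add: Tr_uminus)
  thus "\<exists>\<xi>. two_primitive q n \<xi> \<and> Tr \<xi> = \<beta>" by blast
qed

end
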